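(* Let $\alpha\in\{0,1,2,3,4\}$ and let $m\ge 1$ be an integer such that $(m,\alpha)\notin\{(1,0),(2,2),(4,4),(6,4)\}$. Let $\phi(x)\in\mathbb{Z}[x]$ be a monic polynomial which is irreducible modulo every prime less than or equal to $m+\alpha$. Let $a_m$ be an integer and let $a_0(x),a_1(x),\dots,a_{m-1}(x)\in\mathbb{Z}[x]$ be polynomials, each of degree less than $\deg\phi(x)$, such that the content of the polynomial $a_m a_0(x)$ is not divisible by any prime less than or equal to $m+\alpha$. Then the polynomial $$L_{m,\alpha}^{\phi}(x)=\frac{1}{m!}\Big(a_m\phi(x)^m+\sum_{j=0}^{m-1}b_j\,a_j(x)\,\phi(x)^j\Big),\qquad b_j=\binom{m}{j}(m+\alpha)(m-1+\alpha)\cdots(j+1+\alpha)\quad(0\le j\le m-1),$$ is irreducible over $\mathbb{Q}$.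
   Context: The content of a polynomial in $\mathbb{Z}[x]$ is the greatest common divisor of its coefficients. A monic polynomial $\phi(x)\in\mathbb{Z}[x]$ is irreducible modulo a prime $p$ if its reduction is irreducible in $(\mathbb{Z}/p\mathbb{Z})[x]$ (in particular $\deg\phi\ge 1$). The polynomials $L_{m,\alpha}^{\phi}(x)$ are called generalized $\phi$-Laguerre polynomials. *)

theory Defs
  imports "Berlekamp_Zassenhaus.Poly_Mod"
begin

definition laguerre_coeff :: "nat \<Rightarrow> nat \<Rightarrow> nat \<Rightarrow> nat" where
  "laguerre_coeff m \<alpha> j = (m choose j) * (\<Prod>i = j + 1..m. i + \<alpha>)"

text \<open>
  The factor \<open>1 / m!\<close> makes this a polynomial with rational coefficients. The leading
  coefficient \<open>a\<^sub>m\<close> is the integer \<open>am\<close>; only the values \<open>a 0, \<dots>, a (m - 1)\<close> of \<open>a\<close> are used.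
\<close>

definition gen_laguerre ::
  "nat \<Rightarrow> nat \<Rightarrow> int poly \<Rightarrow> int \<Rightarrow> (nat \<Rightarrow> int poly) \<Rightarrow> rat poly" where
  "gen_laguerre m \<alpha> \<phi> am a =
     smult (1 / fact m)
       (map_poly rat_of_int
         (smult am (\<phi> ^ m) + (\<Sum>j<m. smult (int (laguerre_coeff m \<alpha> j)) (a j * \<phi> ^ j))))"

text \<open>
  \<open>poly_mod.irreducible_m p\<close> is irreducibility in the ring of integer polynomials with
  equality, and hence divisibility, taken modulo \<open>p\<close>; that is, irreducibility of the
  reduction modulo \<open>p\<close>.
\<close>

definition irreducible_mod_primes_upto :: "nat \<Rightarrow> int poly \<Rightarrow> bool" where
  "irreducible_mod_primes_upto n \<phi> \<longleftrightarrow>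
     (\<forall>p::nat. prime p \<and> p \<le> n \<longrightarrow> poly_mod.irreducible_m (int p) \<phi>)"

end

theory Submission
  imports Defs "HOL-Number_Theory.Cong"
begin

text \<open>
  Let \<open>F = \<Sum>j\<le>m. c j * \<phi> ^ j\<close> with \<open>degree (c j) < degree \<phi>\<close> be the given polynomial without the factor
  \<open>1 / m!\<close>, and suppose \<open>F = g * h\<close> over the integers. A prime dividing \<open>m + \<alpha>\<close> divides every
  \<open>b j\<close> with \<open>j < m\<close>, so modulo it \<open>F\<close> is a multiple of \<open>\<phi> ^ m\<close> and the degrees of \<open>g\<close> and \<open>h\<close> are multiples of
  \<open>degree \<phi>\<close>. A factor of degree \<open>k * degree \<phi>\<close> with \<open>2 * k \<le> m\<close> is excluded by the \<open>\<phi>\<close>-Newton polygon at a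
  prime \<open>p\<close> that divides \<open>b j\<close> for all \<open>j \<le> m - k\<close> and for which all slopes are less than \<open>1 / k\<close>.

  Writing \<open>b j\<close> also as \<open>binomial (m + \<alpha>) (j + \<alpha>) * m! / j!\<close>, one sees that for \<open>k \<ge> \<alpha>\<close> every prime
  \<open>p > k + \<alpha>\<close> dividing one of the \<open>k + \<alpha>\<close> consecutive integers \<open>m - k + 1, \<dots>, m + \<alpha>\<close> will do; such a
  prime exists by a slight extension of Sylvester's theorem. As in Erdos's proof of that theorem, if \<open>l\<close> consecutive
  integers have no prime factor above \<open>l\<close>, then removing for each prime \<open>p \<le> l\<close> a member of maximal
  \<open>p\<close>-adic valuation leaves a divisor of \<open>(l - 1)!\<close>, so the integers are at most about \<open>l\<close> to the power \<open>3 / 2\<close>;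
  in that range the smooth binomial coefficient would be too small. For \<open>k < \<alpha>\<close> a finer look at the
  primes 2, 3, 5, 7 leaves only the exceptional pairs.
\<close>

section \<open>Prime factors of consecutive integers\<close>

lemma multiplicity_mult_nat:
  fixes p :: nat
  assumes "prime p" "x > 0" "y > 0"
  shows "multiplicity p (x * y) = multiplicity p x + multiplicity p y"
  using assms by (intro prime_elem_multiplicity_mult_distrib) auto

lemma multiplicity_mono_nat:
  fixes p :: nat
  assumes "x dvd y" "y > 0"
  shows "multiplicity p x \<le> multiplicity p y"
  using assms by (intro dvd_imp_multiplicity_le) auto

lemma multiplicity_fact_block:
  fixes p :: nat
  assumes p: "prime p" and "r < p"
  shows "multiplicity p (fact (p * q + r)) = multiplicity p (fact (p * q) :: nat)"
  using assms(2)
proof (induction r)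
  case (Suc r)
  have "\<not> p dvd p * q + Suc r"
    using Suc.prems nat_dvd_not_less[of "Suc r" p] dvd_add_right_iff[of p "p * q" "Suc r"] by (simp del: add_Suc_right)
  then have "multiplicity p (Suc (p * q + r)) = 0" by (simp add: not_dvd_imp_multiplicity_0)
  moreover have "multiplicity p (fact (Suc (p * q + r))) =
      multiplicity p (Suc (p * q + r)) + multiplicity p (fact (p * q + r) :: nat)"
    unfolding fact_Suc of_nat_id using p by (intro multiplicity_mult_nat) auto
  ultimately show ?case using Suc by simp
qed simp

lemma multiplicity_fact_mult:
  fixes p :: nat
  assumes p: "prime p"
  shows "multiplicity p (fact (p * q) :: nat) = q + multiplicity p (fact q :: nat)"
proof (induction q)
  case (Suc q)
  have p0: "p > 0" using p by (rule prime_gt_0_nat)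
  then have eq: "p * Suc q = Suc (p * q + (p - 1))" by simp
  have "multiplicity p (fact (p * Suc q)) = multiplicity p (p * Suc q) + multiplicity p (fact (p * q + (p - 1)) :: nat)"
    unfolding eq fact_Suc of_nat_id using p by (intro multiplicity_mult_nat) auto
  also have "multiplicity p (p * Suc q) = 1 + multiplicity p (Suc q)"
    using p p0 by (simp add: multiplicity_mult_nat del: mult_Suc_right)
  also have "multiplicity p (fact (p * q + (p - 1))) = multiplicity p (fact (p * q) :: nat)"
    using p0 by (intro multiplicity_fact_block p) auto
  also have "multiplicity p (fact (Suc q)) = multiplicity p (Suc q) + multiplicity p (fact q :: nat)"
    unfolding fact_Suc of_nat_id using p by (intro multiplicity_mult_nat) auto
  ultimately show ?case using Suc by simp
qed simp

text \<open>One step of Legendre's formula: only the multiples of \<open>p\<close> up to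
  \<open>n\<close> contribute, and dividing \<open>p\<close> out of each of them leaves the
  factorial of \<open>n div p\<close>.\<close>

lemma multiplicity_fact_div:
  fixes p :: nat
  assumes "prime p"
  shows "multiplicity p (fact n :: nat) = n div p + multiplicity p (fact (n div p) :: nat)"
  using multiplicity_fact_block[OF assms, of "n mod p" "n div p"] multiplicity_fact_mult[OF assms, of "n div p"]
    prime_gt_0_nat[OF assms] by simp

text \<open>In Legendre's formula the left-hand side is \<open>n\<close> minus the digit sum of
  \<open>n\<close> in base \<open>p\<close>. The slope estimates below rest on this strict
  bound.\<close>

lemma multiplicity_fact_less:
  fixes p :: nat
  assumes p: "prime p"
  shows "n > 0 \<Longrightarrow> (p - 1) * multiplicity p (fact n :: nat) < n"
proof (induction n rule: less_induct)
  case (less n)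
  let ?q = "n div p"
  show ?case
  proof (cases "?q = 0")
    case True
    then show ?thesis using less.prems multiplicity_fact_div[OF p, of n] by simp
  next
    case False
    then have "?q < n" using prime_gt_1_nat[OF p] less.prems by simp
    then have "(p - 1) * multiplicity p (fact ?q :: nat) < ?q" using less.IH False by simp
    then have "(p - 1) * multiplicity p (fact n :: nat) < (p - 1) * ?q + ?q"
      by (subst multiplicity_fact_div[OF p]) (simp add: distrib_left)
    also have "\<dots> = p * ?q" using prime_gt_0_nat[OF p] by (cases p) auto
    finally show ?thesis using times_div_less_eq_dividend[of p n] by (rule less_le_trans)
  qed
qed

lemma prod_diff_below: "(\<Prod>s\<in>{N..<t}. t - s) = fact (t - N)" for t N :: nat
proof -
  have "(\<Prod>s\<in>{N..<t}. t - s) = (\<Prod>i\<in>{1..t - N}. i)"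
    by (rule prod.reindex_bij_witness[of _ "\<lambda>i. t - i" "\<lambda>s. t - s"]) auto
  then show ?thesis by (simp add: fact_prod)
qed

lemma prod_diff_above: "(\<Prod>s\<in>{Suc t..<n}. s - t) = fact (n - Suc t)" for t n :: nat
proof -
  have "(\<Prod>s\<in>{Suc t..<n}. s - t) = (\<Prod>i\<in>{1..n - Suc t}. i)"
    by (rule prod.reindex_bij_witness[of _ "\<lambda>i. t + i" "\<lambda>s. s - t"]) auto
  then show ?thesis by (simp add: fact_prod)
qed

text \<open>Take \<open>t\<close> of maximal \<open>p\<close>-adic valuation in the window; then the valuation of any other
  member \<open>s\<close> is at most that of the distance between \<open>s\<close> and \<open>t\<close>.\<close>
lemma window_multiplicity:
  fixes p :: nat
  assumes p: "prime p" and N: "N > 0" and l: "l > 0"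
  shows "\<exists>t\<in>{N..<N + l}. multiplicity p (\<Prod>({N..<N + l} - {t})) \<le> multiplicity p (fact (l - 1) :: nat)"
proof -
  let ?W = "{N..<N + l}"
  have "Max (multiplicity p ` ?W) \<in> multiplicity p ` ?W" using l by (intro Max_in) auto
  then obtain t where t: "t \<in> ?W" "multiplicity p t = Max (multiplicity p ` ?W)" by auto
  have max: "multiplicity p s \<le> multiplicity p t" if "s \<in> ?W" for s
    unfolding t(2) using that by (intro Max_ge) auto
  have le: "multiplicity p s \<le> multiplicity p (d s)"
    if s: "s \<in> ?W - {t}" and d: "d s = (if s < t then t - s else s - t)" for s and d :: "nat \<Rightarrow> nat"
  proof -
    have "p ^ multiplicity p s dvd s" "p ^ multiplicity p s dvd t"
      using s max by (auto intro: multiplicity_dvd multiplicity_dvd')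
    then have "p ^ multiplicity p s dvd d s" using d by (auto intro: dvd_diff_nat)
    moreover have "d s > 0" using s d by auto
    ultimately show ?thesis using p by (intro multiplicity_geI) auto
  qed
  define d where "d s = (if s < t then t - s else s - t)" for s
  have W: "?W - {t} = {N..<t} \<union> {Suc t..<N + l}" using t(1) by auto
  have "multiplicity p (\<Prod>(?W - {t})) = (\<Sum>s\<in>?W - {t}. multiplicity p s)"
    using p N by (intro prime_elem_multiplicity_prod_distrib) auto
  also have "\<dots> \<le> (\<Sum>s\<in>?W - {t}. multiplicity p (d s))"
    by (intro sum_mono le) (auto simp: d_def)
  also have "\<dots> = multiplicity p (\<Prod>s\<in>?W - {t}. d s)"
    using p by (intro prime_elem_multiplicity_prod_distrib[symmetric]) (auto simp: d_def)
  also have "(\<Prod>s\<in>?W - {t}. d s) = (\<Prod>s\<in>{N..<t}. t - s) * (\<Prod>s\<in>{Suc t..<N + l}. s - t)"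
    unfolding W by (subst prod.union_disjoint) (auto simp: d_def intro!: arg_cong2[of _ _ _ _ "(*)"] prod.cong)
  also have "\<dots> = fact (t - N) * fact (N + l - Suc t)" by (simp only: prod_diff_below prod_diff_above)
  also have "multiplicity p \<dots> \<le> multiplicity p (fact (l - 1))"
  proof (rule multiplicity_mono_nat)
    have "(t - N) + (N + l - Suc t) = l - 1" using t(1) by auto
    then show "fact (t - N) * fact (N + l - Suc t) dvd (fact (l - 1) :: nat)"
      by (metis fact_fact_dvd_fact)
  qed simp
  finally show ?thesis using t(1) by blast
qed

lemma prod_window_eq_fact_mult_binomial:
  assumes "k \<le> n"
  shows "\<Prod>{n - k + 1..<n - k + 1 + k} = fact k * (n choose k)"
proof -
  have "fact (n - k) * \<Prod>{n - k + 1..<n - k + 1 + k} = fact n"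
  proof -
    have "{1..n} = {1..n - k} \<union> {n - k + 1..<n - k + 1 + k}" using assms by auto
    moreover have "{1..n - k} \<inter> {n - k + 1..<n - k + 1 + k} = {}" by auto
    ultimately show ?thesis unfolding fact_prod by (simp add: prod.union_disjoint)
  qed
  also have "\<dots> = fact (n - k) * (fact k * (n choose k))"
    using binomial_fact_lemma[OF assms] by (simp add: ac_simps)
  finally show ?thesis by simp
qed

text \<open>Without a member \<open>t\<close> of maximal valuation, the window of the
  \<open>k\<close> integers up to \<open>n\<close> has no more factors \<open>p\<close> than
  \<open>fact (k - 1)\<close>, hence no more than \<open>fact k\<close>. So all factors
  \<open>p\<close> of the binomial coefficient fit into \<open>t\<close>, which is at most
  \<open>n\<close>.\<close>

lemma prime_power_binomial_le:
  fixes p :: nat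
  assumes p: "prime p" and k: "0 < k" "k \<le> n"
  shows "p ^ multiplicity p (n choose k) \<le> n"
proof -
  let ?N = "n - k + 1"
  obtain t where t: "t \<in> {?N..<?N + k}"
    "multiplicity p (\<Prod>({?N..<?N + k} - {t})) \<le> multiplicity p (fact (k - 1) :: nat)"
    using window_multiplicity[OF p, of ?N k] k by auto
  have "t * \<Prod>({?N..<?N + k} - {t}) = fact k * (n choose k)"
    using t(1) prod.remove[of "{?N..<?N + k}" t "\<lambda>x. x"] prod_window_eq_fact_mult_binomial[OF k(2)] by simp
  moreover have pos: "\<Prod>({?N..<?N + k} - {t}) > 0" "t > 0" using t(1) by (auto intro!: prod_pos)
  moreover have "(n choose k) > 0" using k by simp
  ultimately have "multiplicity p t + multiplicity p (\<Prod>({?N..<?N + k} - {t})) =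
      multiplicity p (fact k :: nat) + multiplicity p (n choose k)"
    using multiplicity_mult_nat[OF p] by (metis fact_gt_zero)
  moreover have "multiplicity p (fact (k - 1) :: nat) \<le> multiplicity p (fact k :: nat)"
    by (intro multiplicity_mono_nat fact_dvd) auto
  ultimately have "multiplicity p (n choose k) \<le> multiplicity p t" using t(2) by linarith
  then have "p ^ multiplicity p (n choose k) dvd t" by (rule multiplicity_dvd')
  then have "p ^ multiplicity p (n choose k) \<le> t" using pos(2) by (rule dvd_imp_le)
  then show ?thesis using t(1) k by auto
qed

section \<open>Smooth windows and the number of primes\<close>

definition prime_count :: "nat \<Rightarrow> nat" where
  "prime_count n = card {p. prime p \<and> p \<le> n}"

lemma finite_primes_le [simp]: "finite {p::nat. prime p \<and> p \<le> n}"
  by (rule finite_subset[of _ "{..n}"]) auto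

text \<open>Erdos's argument: remove, for each prime up to \<open>l\<close>, a member of maximal
  valuation. The product of the remaining members divides \<open>fact (l - 1)\<close>, and each of
  them is at least \<open>N\<close>.\<close>

lemma smooth_window_bound:
  assumes N: "N > 0" and l: "l > 0"
    and smooth: "\<And>p t. prime p \<Longrightarrow> t \<in> {N..<N + l} \<Longrightarrow> p dvd t \<Longrightarrow> p \<le> l"
  shows "N ^ (l - prime_count l) \<le> fact (l - 1)"
proof -
  let ?W = "{N..<N + l}" and ?P = "{p. prime p \<and> p \<le> l}"
  have "\<forall>p\<in>?P. \<exists>t. t \<in> ?W \<and> multiplicity p (\<Prod>(?W - {t})) \<le> multiplicity p (fact (l - 1) :: nat)"
    using window_multiplicity[OF _ N l] by blast
  from bchoice[OF this] obtain T where T: "\<forall>p\<in>?P. T p \<in> ?W \<and>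
    multiplicity p (\<Prod>(?W - {T p})) \<le> multiplicity p (fact (l - 1) :: nat)" ..
  define R where "R = ?W - T ` ?P"
  have pos: "x > 0" if "x \<in> ?W" for x using that N by auto
  then have R0: "\<Prod>R > 0" by (intro prod_pos) (auto simp: R_def)
  have "card ?W - card (T ` ?P) \<le> card R" unfolding R_def by (intro diff_card_le_card_Diff) simp
  \<comment> \<open>One member may be removed on behalf of several primes, so this is only an upper
    bound.\<close>
  moreover have "card (T ` ?P) \<le> prime_count l" unfolding prime_count_def by (rule card_image_le) simp
  ultimately have cR: "l - prime_count l \<le> card R" by simp
  have "\<Prod>R dvd fact (l - 1)"
  proof (rule multiplicity_le_imp_dvd)
    fix p :: nat assume p: "prime p"
    show "multiplicity p (\<Prod>R) \<le> multiplicity p (fact (l - 1))"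
    proof (cases "p \<le> l")
      case True
      then have P: "p \<in> ?P" using p by simp
      have "\<Prod>R dvd \<Prod>(?W - {T p})" using P by (intro prod_dvd_prod_subset) (auto simp: R_def)
      moreover have "\<Prod>(?W - {T p}) > 0" using pos by (intro prod_pos) auto
      ultimately have "multiplicity p (\<Prod>R) \<le> multiplicity p (\<Prod>(?W - {T p}))" by (rule multiplicity_mono_nat)
      then show ?thesis using bspec[OF T P] by simp
    next
      case False
      have "\<not> p dvd \<Prod>R"
      proof
        assume "p dvd \<Prod>R"
        then obtain t where "t \<in> R" "p dvd t" using p by (auto simp: R_def prime_dvd_prod_iff)
        then show False using smooth[OF p, of t] False by (auto simp: R_def)
      qed
      then show ?thesis by (simp add: not_dvd_imp_multiplicity_0)
    qed
  qed (use R0 in simp)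
  then have le: "\<Prod>R \<le> fact (l - 1)" by (rule dvd_imp_le) simp
  have "N ^ (l - prime_count l) \<le> N ^ card R" using N cR by (intro power_increasing) auto
  also have "\<dots> = (\<Prod>x\<in>R. N)" by simp
  also have "\<dots> \<le> \<Prod>R" by (intro prod_mono) (auto simp: R_def)
  finally show ?thesis using le by simp
qed

lemma prime_count_Suc: "prime_count (Suc n) = (if prime (Suc n) then prime_count n + 1 else prime_count n)"
proof (cases "prime (Suc n)")
  case True
  then have "{p. prime p \<and> p \<le> Suc n} = insert (Suc n) {p. prime p \<and> p \<le> n}" by (auto simp: le_Suc_eq)
  then show ?thesis using True by (simp add: prime_count_def)
next
  case False
  then have "{p. prime p \<and> p \<le> Suc n} = {p. prime p \<and> p \<le> n}" by (auto simp: le_Suc_eq)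
  then show ?thesis using False by (simp add: prime_count_def)
qed

lemma prime_mod_6:
  assumes p: "prime (p::nat)" and "p > 3"
  shows "p mod 6 = 1 \<or> p mod 6 = 5"
proof -
  have "\<not> 2 dvd p" "\<not> 3 dvd p" using assms prime_nat_iff[of p] by auto
  then show ?thesis by presburger
qed

text \<open>Primes above 3 are 1 or 5 modulo 6, and six consecutive integers contain one member of
  each class.\<close>

lemma prime_count_add_6:
  assumes "n \<ge> 3"
  shows "prime_count (n + 6) \<le> prime_count n + 2"
proof -
  define E where "E c = {x\<in>{n<..n + 6}. x mod 6 = c}" for c
  have "card (E c) \<le> 1" for c
  proof -
    have "x = y" if "n < x" "x \<le> n + 6" "n < y" "y \<le> n + 6" "x mod 6 = y mod 6" for x y :: nat
    proof -
      have "6 * (x div 6) + y mod 6 = x" "6 * (y div 6) + y mod 6 = y" using that(5) mult_div_mod_eq by metis+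
      then have "x div 6 = y div 6" using that by linarith
      then show ?thesis using that(5) by (metis div_mult_mod_eq)
    qed
    then show ?thesis by (simp add: card_le_Suc0_iff_eq E_def)
  qed
  then have E: "card (E 1) + card (E 5) \<le> 2" by (metis add_mono one_add_one)
  have "{p. prime p \<and> p \<le> n + 6} \<subseteq> {p. prime p \<and> p \<le> n} \<union> (E 1 \<union> E 5)"
  proof
    fix p assume "p \<in> {p. prime p \<and> p \<le> n + 6}"
    then show "p \<in> {p. prime p \<and> p \<le> n} \<union> (E 1 \<union> E 5)"
      using prime_mod_6[of p] assms by (cases "p \<le> n") (auto simp: E_def)
  qed
  then have "prime_count (n + 6) \<le> card ({p. prime p \<and> p \<le> n} \<union> (E 1 \<union> E 5))"
    unfolding prime_count_def by (intro card_mono) (auto simp: E_def)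
  also have "\<dots> \<le> prime_count n + card (E 1 \<union> E 5)" unfolding prime_count_def by (rule card_Un_le)
  also have "\<dots> \<le> prime_count n + 2" using card_Un_le[of "E 1" "E 5"] E by simp
  finally show ?thesis .
qed

lemma prime_count_numeral:
  "prime_count (numeral k) = (if prime (numeral k :: nat) then prime_count (pred_numeral k) + 1 else prime_count (pred_numeral k))"
  using prime_count_Suc[of "pred_numeral k"] by (simp only: numeral_eq_Suc)

lemma prime_count_0_1: "prime_count 0 = 0" "prime_count (Suc 0) = 0"
  by (auto simp: prime_count_def card_eq_0_iff dest: prime_ge_2_nat)

lemma prime_count_le: "3 * prime_count n \<le> n + 5"
proof (induction n rule: less_induct)
  case (less n)
  show ?case
  proof (cases "n < 9")
    case True
    then have "n \<in> {0,1,2,3,4,5,6,7,8}" by auto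
    then show ?thesis by (auto simp: prime_count_0_1 prime_count_numeral)
  next
    case False
    then have "prime_count n \<le> prime_count (n - 6) + 2" using prime_count_add_6[of "n - 6"] by simp
    then show ?thesis using less[of "n - 6"] False by simp
  qed
qed

text \<open>Steps of six from the base cases 33 to 38. The threshold is sharp, since there are 11
  primes up to 32.\<close>

lemma prime_count_le_third: "n \<ge> 33 \<Longrightarrow> 3 * prime_count n \<le> n"
proof (induction n rule: less_induct)
  case (less n)
  show ?case
  proof (cases "n < 39")
    case True
    then have "n \<in> {33,34,35,36,37,38}" using less.prems by auto
    then show ?thesis by (auto simp: prime_count_0_1 prime_count_numeral)
  next
    case False
    then have "prime_count n \<le> prime_count (n - 6) + 2" using prime_count_add_6[of "n - 6"] by simp
    then show ?thesis using less.IH[of "n - 6"] False by linarith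
  qed
qed

section \<open>The product of the primes up to a bound\<close>

lemma prod_primes_dvd:
  fixes A :: "nat set"
  assumes "finite A" "\<And>p. p \<in> A \<Longrightarrow> prime p" "\<And>p. p \<in> A \<Longrightarrow> p dvd x"
  shows "\<Prod>A dvd x"
  using assms
proof (induction A rule: finite_induct)
  case (insert p A)
  have "\<not> p dvd \<Prod>A"
  proof
    assume "p dvd \<Prod>A"
    then obtain q where "q \<in> A" "p dvd q" using insert by (auto simp: prime_dvd_prod_iff)
    then show False using insert.hyps(2) insert.prems(1) primes_dvd_imp_eq[of p q] by auto
  qed
  then have "p * \<Prod>A dvd x" using insert by (intro divides_mult prime_imp_coprime) auto
  then show ?case using insert.hyps by simp
qed simp

lemma binomial_odd_middle_le: "(2 * m + 1 choose m) \<le> 4 ^ m"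
proof -
  have "2 * (2 * m + 1 choose m) = (\<Sum>k\<in>{m, m + 1}. 2 * m + 1 choose k)"
    using binomial_symmetric[of m "2 * m + 1"] by simp
  also have "\<dots> \<le> (\<Sum>k\<le>2 * m + 1. 2 * m + 1 choose k)" by (rule sum_mono2) auto
  also have "\<dots> = 2 * 4 ^ m" by (simp only: choose_row_sum) (simp add: power_mult)
  finally show ?thesis by simp
qed

definition primorial :: "nat \<Rightarrow> nat" where
  "primorial n = \<Prod>{p. prime p \<and> p \<le> n}"

text \<open>For \<open>n = 2 * m + 1\<close> the primes above \<open>m + 1\<close> all divide the
  binomial coefficient of \<open>n\<close> over \<open>m\<close>, which is at most
  \<open>4 ^ m\<close>; the primes up to \<open>m + 1\<close> are left to the induction.\<close>

lemma primorial_le: "primorial n \<le> 4 ^ n"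
proof (induction n rule: less_induct)
  case (less n)
  consider "n = 0" | "n = 1" | "n = 2" | "n > 2" "even n" | "odd n" "n > 2" by linarith
  then show ?case
  proof cases
    case 3
    have "{p. prime p \<and> p \<le> (2::nat)} = {2}" by (auto dest: prime_ge_2_nat)
    then show ?thesis using 3 by (simp add: primorial_def)
  next
    case 4
    then have "\<not> prime n" using prime_odd_nat by blast
    then have "{p. prime p \<and> p \<le> n} = {p. prime p \<and> p \<le> n - 1}" by (auto simp: le_less) 
    then have "primorial n = primorial (n - 1)" by (simp add: primorial_def)
    also have "\<dots> \<le> 4 ^ (n - 1)" using less 4 by simp
    also have "\<dots> \<le> 4 ^ n" by (rule power_increasing) auto
    finally show ?thesis .
  next
    case 5
    then obtain m where m: "n = 2 * m + 1" by (auto elim: oddE)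
    let ?A = "{p. prime p \<and> p \<le> m + 1}" and ?B = "{p. prime p \<and> m + 1 < p \<and> p \<le> n}"
    have finB: "finite ?B" by (rule finite_subset[of _ "{..n}"]) auto
    have "\<Prod>?B dvd (2 * m + 1 choose m)"
    proof (rule prod_primes_dvd[OF finB])
      fix p assume p: "p \<in> ?B"
      then have "p dvd fact n" using prime_dvd_fact_iff by auto
      also have "(fact n :: nat) = fact m * fact (m + 1) * (2 * m + 1 choose m)"
        using binomial_fact_lemma[of m n] by (simp add: m)
      finally show "p dvd (2 * m + 1 choose m)"
        using p by (auto simp: prime_dvd_mult_iff prime_dvd_fact_iff simp del: fact_Suc)
    qed auto
    then have "\<Prod>?B \<le> (2 * m + 1 choose m)" by (rule dvd_imp_le) simp
    also have "\<dots> \<le> 4 ^ m" by (rule binomial_odd_middle_le)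
    finally have B: "\<Prod>?B \<le> 4 ^ m" .
    have "{p. prime p \<and> p \<le> n} = ?A \<union> ?B" using m by auto
    then have "primorial n = primorial (m + 1) * \<Prod>?B"
      unfolding primorial_def using finB by (simp add: prod.union_disjoint disjoint_iff)
    also have "\<dots> \<le> 4 ^ (m + 1) * 4 ^ m" using B less[of "m + 1"] m 5 by (intro mult_mono) auto
    also have "\<dots> = 4 ^ n" by (simp add: m power_add mult_2)
    finally show ?thesis .
  next
    case 1
    then have *: "{p. prime p \<and> p \<le> n} = {}" by auto
    show ?thesis unfolding primorial_def * by simp
  next
    case 2
    then have *: "{p. prime p \<and> p \<le> n} = {}" by (auto dest: prime_ge_2_nat)
    show ?thesis unfolding primorial_def * by simp
  qed
qed

section \<open>Size of binomial coefficients without large prime factors\<close>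

text \<open>At most two factors \<open>p\<close> occur in \<open>fact n\<close>, and
  \<open>fact k\<close> and \<open>fact (n - k)\<close> use up one each.\<close>

lemma prime_not_dvd_binomial:
  fixes p :: nat
  assumes p: "prime p" and "p \<le> k" "2 * k \<le> n" "n < 3 * p" "2 < p"
  shows "\<not> p dvd (n choose k)"
proof
  assume dvd: "p dvd (n choose k)"
  have pos: "(n choose k) > 0" using assms by simp
  have "n div p < 3" using assms by (simp add: less_mult_imp_div_less)
  then have "n div p \<in> {0, 1, 2}" by auto
  moreover have "\<not> p dvd 2" using assms by (auto dest: dvd_imp_le)
  ultimately have "multiplicity p (fact n :: nat) \<le> 2"
    by (subst multiplicity_fact_div[OF p]) (auto simp: fact_2 not_dvd_imp_multiplicity_0)
  also have "(fact n :: nat) = fact k * fact (n - k) * (n choose k)"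
    using assms by (simp add: binomial_fact_lemma)
  also have "multiplicity p \<dots> = multiplicity p (fact k :: nat) + multiplicity p (fact (n - k) :: nat) + multiplicity p (n choose k)"
    using p pos by (simp add: multiplicity_mult_nat)
  finally have "multiplicity p (fact k :: nat) + multiplicity p (fact (n - k) :: nat) + multiplicity p (n choose k) \<le> 2" .
  moreover have "multiplicity p x > 0" if "p dvd x" "x > 0" for x :: nat
    using that p by (simp add: prime_multiplicity_gt_zero_iff)
  then have "multiplicity p (fact k :: nat) > 0" "multiplicity p (fact (n - k) :: nat) > 0" "multiplicity p (n choose k) > 0"
    using assms dvd pos by (simp_all add: prime_dvd_fact_iff)
  ultimately show False by linarith
qed

text \<open>Split the prime factors in three. Each prime up to \<open>s\<close> contributes at most
  \<open>n\<close>. A prime above \<open>s\<close> has a square exceeding \<open>n\<close>, so it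
  occurs only once; those up to \<open>min k (n div 3)\<close> are controlled by the primorial.
  Primes above \<open>n div 3\<close> but not above \<open>k\<close> do not occur, which leaves at
  most the four candidates \<open>k + 1, ..., k + 4\<close>.\<close>

lemma smooth_binomial_upper:
  assumes k: "k > 0" "2 * k \<le> n" and n: "n \<ge> 9" "n < (s + 1) ^ 2"
    and smooth: "\<And>p. prime p \<Longrightarrow> p dvd (n choose k) \<Longrightarrow> p \<le> k + 4"
  shows "(n choose k) \<le> n ^ prime_count s * 4 ^ min k (n div 3) * (k + 4) ^ 4"
proof -
  let ?B = "n choose k"
  have B0: "?B > 0" using k by simp
  let ?v = "\<lambda>p. p ^ multiplicity p ?B"
  define S where "S = {p \<in> prime_factors ?B. p \<le> s}"
  define L where "L = {p \<in> prime_factors ?B. s < p \<and> p \<le> min k (n div 3)}"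
  define X where "X = {p \<in> prime_factors ?B. s < p \<and> \<not> p \<le> min k (n div 3)}"
  have pf: "prime p" "p dvd ?B" if "p \<in> prime_factors ?B" for p using that by auto
  have le: "?v p \<le> n" if "p \<in> prime_factors ?B" for p
    using prime_power_binomial_le[OF pf(1)[OF that]] k by simp
  have le1: "?v p \<le> p" if "p \<in> prime_factors ?B" "s < p" for p
  proof -
    have "p ^ multiplicity p ?B < p ^ 2"
    proof -
      have "(s + 1) ^ 2 \<le> p ^ 2" using that(2) by (intro power_mono) auto
      then show ?thesis using le[OF that(1)] n(2) by linarith
    qed
    then have "multiplicity p ?B < 2"
      by (rule power_less_imp_less_exp[OF prime_gt_1_nat[OF pf(1)[OF that(1)]]])
    then have "?v p \<le> p ^ 1" using prime_gt_0_nat[OF pf(1)[OF that(1)]] by (intro power_increasing) auto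
    then show ?thesis by simp
  qed
  have "?B = (\<Prod>p\<in>prime_factors ?B. ?v p)" using B0 by (intro prime_factorization_nat) auto
  also have "prime_factors ?B = S \<union> (L \<union> X)" by (auto simp: S_def L_def X_def)
  also have "(\<Prod>p\<in>S \<union> (L \<union> X). ?v p) = (\<Prod>p\<in>S. ?v p) * ((\<Prod>p\<in>L. ?v p) * (\<Prod>p\<in>X. ?v p))"
    by (subst prod.union_disjoint, simp_all add: S_def L_def X_def disjoint_iff)
      (subst prod.union_disjoint, auto)
  also have "\<dots> \<le> n ^ prime_count s * (4 ^ min k (n div 3) * (k + 4) ^ 4)"
  proof (intro mult_mono)
    have "(\<Prod>p\<in>S. ?v p) \<le> (\<Prod>p\<in>S. n)" by (intro prod_mono conjI le) (auto simp: S_def)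
    also have "\<dots> = n ^ card S" by simp
    also have "card S \<le> prime_count s" unfolding prime_count_def by (intro card_mono) (auto simp: S_def)
    then have "n ^ card S \<le> n ^ prime_count s" using n by (intro power_increasing) auto
    finally show "(\<Prod>p\<in>S. ?v p) \<le> n ^ prime_count s" .
    have "(\<Prod>p\<in>L. ?v p) \<le> \<Prod>L" by (intro prod_mono conjI le1) (auto simp: L_def)
    also have "\<dots> \<le> primorial (min k (n div 3))" unfolding primorial_def
      by (intro dvd_imp_le prod_dvd_prod_subset prod_pos) (auto simp: L_def dest: prime_gt_0_nat)
    also have "\<dots> \<le> 4 ^ min k (n div 3)" by (rule primorial_le)
    finally show "(\<Prod>p\<in>L. ?v p) \<le> 4 ^ min k (n div 3)" .
    have X: "X \<subseteq> {k + 1..k + 4}"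
    proof
      fix p assume "p \<in> X"
      then have p: "p \<in> prime_factors ?B" "\<not> p \<le> min k (n div 3)" by (auto simp: X_def)
      have "\<not> p \<le> k"
      proof
        assume "p \<le> k"
        then have "n < 3 * p" using p(2) by simp
        then show False using prime_not_dvd_binomial[of p k n] pf[OF p(1)] \<open>p \<le> k\<close> k n by simp
      qed
      then show "p \<in> {k + 1..k + 4}" using smooth pf[OF p(1)] by auto
    qed
    have "(\<Prod>p\<in>X. ?v p) \<le> \<Prod>X" by (intro prod_mono conjI le1) (auto simp: X_def)
    also have "\<dots> \<le> (\<Prod>p\<in>X. k + 4)" using X by (intro prod_mono) auto
    also have "\<dots> = (k + 4) ^ card X" by simp
    also have "\<dots> \<le> (k + 4) ^ 4" using card_mono[OF _ X] by (intro power_increasing) auto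
    finally show "(\<Prod>p\<in>X. ?v p) \<le> (k + 4) ^ 4" .
  qed auto
  finally show ?thesis by (simp add: mult.assoc)
qed

lemma binomial_step_ge:
  assumes "k \<le> n" "Suc n \<le> 3 * k"
  shows "3 / 2 * real (n choose k) \<le> real (Suc n choose k)"
proof -
  have "real (Suc n - k) * real (Suc n choose k) = real (Suc n) * real (n choose k)"
    using binomial_absorb_comp[of "Suc n" k] by (metis diff_Suc_1 of_nat_mult)
  moreover have "3 / 2 * real (Suc n - k) \<le> real (Suc n)" using assms by (simp add: of_nat_diff)
  then have "3 / 2 * real (Suc n - k) * real (n choose k) \<le> real (Suc n) * real (n choose k)"
    by (intro mult_right_mono) auto
  ultimately have "real (Suc n - k) * (3 / 2 * real (n choose k)) \<le> real (Suc n - k) * real (Suc n choose k)"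
    by (simp add: ac_simps)
  moreover have "real (Suc n - k) > 0" using assms by simp
  ultimately show ?thesis using mult_le_cancel_left_pos by blast
qed

lemma binomial_ge_power:
  assumes "t \<le> k"
  shows "real (2 * k choose k) * (3 / 2) ^ t \<le> real (2 * k + t choose k)"
  using assms
proof (induction t)
  case (Suc t)
  have "real (2 * k choose k) * (3 / 2) ^ Suc t \<le> 3 / 2 * real (2 * k + t choose k)" using Suc by simp
  also have "\<dots> \<le> real (Suc (2 * k + t) choose k)" using Suc.prems by (intro binomial_step_ge) auto
  finally show ?case by simp
qed simp

text \<open>Start from the central binomial coefficient, about \<open>4 ^ k\<close>, and gain a
  factor \<open>3 / 2\<close> for each of the \<open>t\<close> steps from \<open>2 * k\<close>
  towards \<open>3 * k\<close>. If \<open>n\<close> stops \<open>j\<close> steps short of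
  \<open>3 * k\<close>, then the exponent of 4 on the left is smaller than \<open>k\<close> by some
  \<open>c\<close> with \<open>j \<le> 3 * c\<close>, and this makes up for the loss because
  \<open>(3 / 2) ^ 3 < 4\<close>.\<close>

lemma binomial_lower:
  assumes k: "k > 0" "2 * k \<le> n"
  shows "(3 / 2) ^ k * 4 ^ min k (n div 3) \<le> 2 * real k * real (n choose k)"
proof -
  define t where "t = min k (n - 2 * k)"
  define j where "j = k - t"
  define c where "c = k - min k (n div 3)"
  have "j \<le> 3 * c" "c \<le> k" "j + t = k" using k(2) by (auto simp: j_def c_def t_def)
  have "(3 / 2 :: real) ^ j \<le> (3 / 2) ^ (3 * c)" using \<open>j \<le> 3 * c\<close> by (intro power_increasing) auto
  also have "\<dots> = (27 / 8) ^ c" by (simp add: power_mult power3_eq_cube)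
  also have "\<dots> \<le> 4 ^ c" by (intro power_mono) auto
  finally have jc: "(3 / 2 :: real) ^ j \<le> 4 ^ c" .
  have "(3 / 2 :: real) ^ k * 4 ^ min k (n div 3) = (3 / 2) ^ t * ((3 / 2) ^ j * 4 ^ min k (n div 3))"
    using \<open>j + t = k\<close> by (simp flip: power_add)
  also have "\<dots> \<le> (3 / 2) ^ t * (4 ^ c * 4 ^ min k (n div 3))"
    using jc by (intro mult_left_mono mult_right_mono) auto
  also have "4 ^ c * 4 ^ min k (n div 3) = (4 ^ k :: real)" by (simp add: c_def flip: power_add)
  also have "(4 ^ k :: real) \<le> 2 * real k * real (2 * k choose k)"
    using central_binomial_lower_bound[OF k(1)] k(1) by (simp add: field_simps)
  also have "(3 / 2) ^ t * (2 * real k * real (2 * k choose k)) = 2 * real k * (real (2 * k choose k) * (3 / 2) ^ t)"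
    by simp
  also have "\<dots> \<le> 2 * real k * real (2 * k + t choose k)"
    by (intro mult_left_mono binomial_ge_power) (auto simp: t_def)
  also have "\<dots> \<le> 2 * real k * real (n choose k)"
    using k(2) by (intro mult_left_mono of_nat_mono binomial_right_mono) (auto simp: t_def)
  finally show ?thesis by simp
qed

section \<open>Numerical estimates for long windows\<close>

lemma ln_three_halves_ge: "2 / 5 \<le> ln (3 / 2 :: real)"
proof -
  have "(2 / 3 :: real) \<le> (1 + (- (2 / 5)) / real 20) ^ 20" by (simp add: field_simps)
  also have "\<dots> \<le> exp (- (2 / 5))" by (rule exp_ge_one_plus_x_over_n_power_n) auto
  finally have "exp (2 / 5) \<le> (3 / 2 :: real)" by (simp add: exp_minus field_simps)
  then show ?thesis by (simp only: ln_ge_iff)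
qed

lemma ln_2_le: "ln (2 :: real) \<le> 7 / 10"
proof -
  have "(2 :: real) \<le> (1 + (7 / 10) / real 40) ^ 40" by (simp add: field_simps)
  also have "\<dots> \<le> exp (7 / 10)" by (rule exp_ge_one_plus_x_over_n_power_n) auto
  finally have "ln (2 :: real) \<le> ln (exp (7 / 10))" by (intro ln_mono) auto
  then show ?thesis by (simp only: ln_exp)
qed

lemma ln_le_tangent_8:
  assumes "(u::real) > 0"
  shows "ln u \<le> u / 8 + 11 / 10"
proof -
  have "ln u = ln (u / 8) + ln (2 ^ 3)" using assms by (simp add: ln_div)
  also have "ln (u / 8) \<le> u / 8 - 1" using assms by (intro ln_le_minus_one) simp
  also have "ln (2 ^ 3 :: real) = 3 * ln 2" by (simp only: ln_realpow)
  finally show ?thesis using ln_2_le by simp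
qed

text \<open>For \<open>k = u ^ 4\<close> the left-hand side bounds the logarithm of \<open>2 * k * (k + 4) ^ 4 * n ^ \<pi>(\<surd>n)\<close>
  and the right-hand side that of \<open>(3 / 2) ^ k\<close>; see \<open>binomial_lower\<close> and \<open>smooth_binomial_upper\<close>.\<close>
lemma quartic_beats_entropy:
  fixes u :: real
  assumes u: "u \<ge> 6"
  shows "7 / 10 + 20 * (u / 8 + 11 / 10) + 2 / 100 + (19 / 90 * u ^ 3) * (3 / 4 * u + 6) < 2 / 5 * u ^ 4"
proof -
  have u2: "36 \<le> u * u" using mult_mono[of 6 u 6 u] u by simp
  have "36 * u \<le> u * u * u" using u2 u by (intro mult_right_mono) auto
  then have u3: "36 * u \<le> u ^ 3" by (simp add: power3_eq_cube)
  have "6 * u ^ 3 \<le> u * u ^ 3" using u by (intro mult_right_mono) auto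
  then have u4: "6 * u ^ 3 \<le> u ^ 4" by (simp add: power3_eq_cube power4_eq_xxxx)
  have *: "(19 / 90 * u ^ 3) * (3 / 4 * u + 6) = 19 / 120 * u ^ 4 + 19 / 15 * u ^ 3"
    by (simp add: power3_eq_cube power4_eq_xxxx algebra_simps)
  have lin: "7 / 10 + 20 * (u / 8 + 11 / 10) + 2 / 100 + (19 / 120 * B + 19 / 15 * A) < 2 / 5 * B"
    if "36 * u \<le> A" "6 * A \<le> B" for A B :: real
    using that u by (simp add: field_simps)
  show ?thesis unfolding * by (rule lin[OF u3 u4])
qed

text \<open>Otherwise the lower and the upper bound for the binomial coefficient apply together and
  the powers of 4 cancel. With \<open>k = u ^ 4\<close> the upper bound on \<open>n\<close> yields
  \<open>n \<le> 2 / 5 * u ^ 6\<close>, so there are only about \<open>u ^ 3\<close> primes below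
  the square root of \<open>n\<close>. Taking logarithms contradicts
  \<open>quartic_beats_entropy\<close>.\<close>

lemma large_prime_divides_binomial:
  assumes k: "k \<ge> 1296" and n: "2 * k \<le> n" "8 * (n - k + 1) ^ 2 \<le> k ^ 3"
  shows "\<exists>p. prime p \<and> k + 4 < p \<and> p dvd (n choose k)"
proof (rule ccontr)
  assume no: "\<not> ?thesis"
  define s where "s = nat \<lfloor>sqrt (real n)\<rfloor>"
  have "real s \<le> sqrt (real n)" "sqrt (real n) < real s + 1" unfolding s_def by simp_all
  then have "real s ^ 2 \<le> sqrt (real n) ^ 2" "sqrt (real n) ^ 2 < (real s + 1) ^ 2"
    by (intro power_mono power_strict_mono; simp)+
  then have s: "real s ^ 2 \<le> real n" and "real n < real ((s + 1) ^ 2)" by (simp_all add: add.commute)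
  then have s': "n < (s + 1) ^ 2" by (simp only: of_nat_less_iff)
  have s33: "s \<ge> 33"
  proof (rule ccontr)
    assume "\<not> s \<ge> 33"
    then have "(s + 1) ^ 2 \<le> 33 ^ 2" by (intro power_mono) auto
    then show False using s' k n by simp
  qed
  define u where "u = sqrt (sqrt (real k))"
  have "u ^ 2 = sqrt (real k)" by (simp add: u_def)
  then have u4: "u ^ 4 = real k" using power_mult[of u 2 2] by simp
  have u6: "u \<ge> 6"
  proof -
    have "6 ^ 4 \<le> u ^ 4" using k u4 by simp
    then show ?thesis using power_mono_iff[of 6 u 4] by (simp add: u_def)
  qed
  have "(8 * (real (n - k + 1)) ^ 2) \<le> real k ^ 3" using of_nat_mono[OF n(2), where 'a = real] by simp
  also have "\<dots> = u ^ 12" using power_mult[of u 4 3] u4 by simp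
  \<comment> \<open>The fraction is just above the reciprocal of the square root of 8.\<close>
  also have "\<dots> \<le> (8 * (3536 / 10000) ^ 2) * u ^ 12"
    using mult_right_mono[of 1 "8 * (3536 / 10000) ^ 2" "u ^ 12"] by (simp add: power2_eq_square)
  also have "\<dots> = 8 * (3536 / 10000 * u ^ 6) ^ 2"
    using power_mult[of u 6 2] by (simp only: power_mult_distrib mult.assoc) simp
  finally have "real (n - k + 1) ^ 2 \<le> (3536 / 10000 * u ^ 6) ^ 2" by (rule mult_left_le_imp_le) simp
  then have "real (n - k + 1) \<le> 3536 / 10000 * u ^ 6" by (rule power2_le_imp_le) (use u6 in simp)
  moreover have "36 * u ^ 4 \<le> u ^ 6"
  proof -
    have "6 ^ 2 * u ^ 4 \<le> u ^ 2 * u ^ 4" using u6 by (intro mult_right_mono power_mono) auto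
    then show ?thesis by (simp flip: power_add)
  qed
  ultimately have nu: "real n \<le> 2 / 5 * u ^ 6" using u4 n(1) by (simp add: of_nat_diff)
  \<comment> \<open>\<open>19 / 30\<close> is just above the square root of
    \<open>2 / 5\<close>.\<close>
  have "(19 / 30 * u ^ 3) ^ 2 = 361 / 900 * u ^ 6"
    using power_mult[of u 3 2] by (simp only: power_mult_distrib) (simp add: power2_eq_square)
  moreover have "0 \<le> u ^ 6" using u6 by simp
  ultimately have "real s ^ 2 \<le> (19 / 30 * u ^ 3) ^ 2" using s nu by linarith
  then have su: "real s \<le> 19 / 30 * u ^ 3" by (rule power2_le_imp_le) (use u6 in simp)
  have "real (3 * prime_count s) \<le> real s" using prime_count_le_third[OF s33] by (simp only: of_nat_le_iff)
  then have pc: "real (prime_count s) \<le> 19 / 90 * u ^ 3" using su by simp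
  have n0: "real n > 0" using n k by simp
  have lnu: "ln u \<le> u / 8 + 11 / 10" using u6 by (intro ln_le_tangent_8) simp
  have "ln (real n) \<le> ln (2 / 5 * u ^ 6)" using nu n0 u6 by (intro ln_mono) auto
  also have "\<dots> = ln (2 / 5) + 6 * ln u" using u6 ln_mult_pos[of "2 / 5" "u ^ 6"] ln_realpow[of u 6] by simp
  also have "ln (2 / 5 :: real) \<le> 2 / 5 - 1" by (rule ln_le_minus_one) simp
  finally have lnn: "ln (real n) \<le> 3 / 4 * u + 6" using lnu by simp
  have lnk: "ln (real k) = 4 * ln u" using u6 by (simp add: ln_realpow flip: u4)
  have "ln (real k + 4) = ln (real k) + ln (1 + 4 / real k)"
  proof -
    have "real k + 4 = real k * (1 + 4 / real k)" using k by (simp add: distrib_left)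
    then show ?thesis using k ln_mult_pos[of "real k" "1 + 4 / real k"] by (simp add: add_pos_nonneg)
  qed
  also have "ln (1 + 4 / real k) \<le> 4 / real k" by (rule ln_add_one_self_le_self) simp
  also have "4 / real k \<le> 1 / 200" using k by (simp add: field_simps)
  finally have lnk4: "ln (real k + 4) \<le> 4 * ln u + 1 / 200" using lnk by simp
  have "(3 / 2) ^ k * 4 ^ min k (n div 3) \<le> 2 * real k * real (n choose k)"
    using k n by (intro binomial_lower) auto
  also have "real (n choose k) \<le> real (n ^ prime_count s * 4 ^ min k (n div 3) * (k + 4) ^ 4)"
    using k n s' no by (intro of_nat_mono smooth_binomial_upper) (auto simp: not_less)
  finally have "(3 / 2) ^ k * 4 ^ min k (n div 3) \<le>
      (2 * real k * (real n ^ prime_count s * (real k + 4) ^ 4)) * 4 ^ min k (n div 3)"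
    using k by (simp add: mult_left_mono ac_simps)
  then have "(3 / 2) ^ k \<le> 2 * real k * (real n ^ prime_count s * (real k + 4) ^ 4)"
    by (rule mult_right_le_imp_le) simp
  then have "ln ((3 / 2) ^ k) \<le> ln (2 * real k * (real n ^ prime_count s * (real k + 4) ^ 4))"
    by (intro ln_mono) auto
  also have "\<dots> = ln 2 + ln (real k) + (real (prime_count s) * ln (real n) + 4 * ln (real k + 4))"
    using k n0 by (simp add: ln_mult_pos ln_realpow)
  finally have "real k * ln (3 / 2) \<le> ln 2 + ln (real k) + (real (prime_count s) * ln (real n) + 4 * ln (real k + 4))"
    by (simp add: ln_realpow)
  moreover have "real (prime_count s) * ln (real n) \<le> (19 / 90 * u ^ 3) * (3 / 4 * u + 6)"
    using pc lnn n k u6 by (intro mult_mono) auto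
  moreover have "u ^ 4 * (2 / 5) \<le> real k * ln (3 / 2)"
    unfolding u4 using ln_three_halves_ge by (intro mult_left_mono) auto
  ultimately have "2 / 5 * u ^ 4 \<le> 7 / 10 + 20 * (u / 8 + 11 / 10) + 2 / 100 + (19 / 90 * u ^ 3) * (3 / 4 * u + 6)"
    using lnk lnk4 lnu ln_2_le by argo
  with quartic_beats_entropy[OF u6] show False by simp
qed

section \<open>Explicit primes for windows of moderate length\<close>

definition trial_primes :: "nat list" where
  "trial_primes = [2, 3, 5, 7, 11, 13, 17, 19, 23, 29, 31, 37, 41, 43, 47, 53, 59, 61, 67, 71, 73, 79, 83,
     89, 97, 101, 103, 107, 109, 113, 127]"

lemma primes_below_131:
  assumes "prime (p::nat)" "p < 131"
  shows "p \<in> set trial_primes"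
proof -
  \<comment> \<open>A composite number below 131 is less than \<open>13 ^ 2\<close>, so it has a
    prime factor at most 11.\<close>
  have "list_all (\<lambda>p. p \<in> set trial_primes \<or> (\<exists>q\<in>{2, 3, 5, 7, 11}. q dvd p)) [2..<131]"
    unfolding trial_primes_def by (simp add: upt_rec_numeral)
  then have "\<forall>p\<in>{2..<131}. p \<in> set trial_primes \<or> (\<exists>q\<in>{2, 3, 5, 7, 11}. q dvd p)"
    by (simp only: list_all_iff set_upt)
  then have "p \<in> set trial_primes \<or> (\<exists>q\<in>{2, 3, 5, 7, 11}. q dvd p)"
    using assms prime_ge_2_nat[OF assms(1)] atLeastLessThan_iff by blast
  moreover have "q \<in> set trial_primes" if "q \<in> {2, 3, 5, 7, 11}" for q
    using that unfolding trial_primes_def by auto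
  moreover have "q = p" if "q \<in> {2, 3, 5, 7, 11}" "q dvd p" for q
    using that assms(1) by (auto simp: prime_nat_iff)
  ultimately show ?thesis by blast
qed

text \<open>Of two complementary divisors of \<open>n\<close> one is below 131. The bound
  \<open>131 ^ 2 = 17161\<close> covers all of \<open>gap_primes\<close>.\<close>

lemma prime_nat_trial_division:
  assumes "1 < n" "n < 131 ^ 2" "\<forall>p\<in>set trial_primes. \<not> p dvd n"
  shows "prime (n::nat)"
proof (rule ccontr)
  assume "\<not> prime n"
  then obtain d where d: "d dvd n" "d \<noteq> 1" "d \<noteq> n" using assms(1) by (auto simp: prime_nat_iff)
  then obtain e where e: "n = d * e" by blast
  have "d < 131 \<or> e < 131"
  proof (rule ccontr)
    assume "\<not> ?thesis"
    then have "131 * 131 \<le> d * e" by (intro mult_le_mono) auto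
    then show False using assms(2) e by (simp add: power2_eq_square)
  qed
  moreover have "e \<noteq> 1" "e dvd n" "d > 0" "e > 0"
    using d e assms(1) by (auto intro!: Nat.gr0I)
  ultimately obtain c where c: "c dvd n" "c \<noteq> 1" "c < 131" "c > 0" using d by blast
  then obtain p where p: "prime p" "p dvd c" using prime_factor_nat by blast
  then have "p \<le> c" using c(4) by (intro dvd_imp_le)
  then have "p \<in> set trial_primes" using primes_below_131[OF p(1)] c(3) by linarith
  then show False using assms(3) dvd_trans[OF p(2) c(1)] by blast
qed

text \<open>Starting from 33, each entry is the largest prime \<open>q\<close> that satisfies the hypothesis of
  \<open>gap_step\<close> for its predecessor \<open>P\<close>.\<close>
definition gap_primes :: "nat list" where
  "gap_primes =
    [61, 89, 113, 151, 199, 263, 337, 421, 523, 647, 787, 953, 1129, 1327, 1559, 1823, 2113,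
     2437, 2791, 3181, 3607, 4073, 4567, 5113, 5701, 6329, 7001, 7727, 8501, 9323, 10193,
     11119, 12109, 13159, 14251, 15413, 16633]"

lemma prime_gap_primes: "q \<in> set gap_primes \<Longrightarrow> prime q"
proof (cases "q < 131")
  case True
  assume "q \<in> set gap_primes"
  then have "q \<in> {61, 89, 113}" using True unfolding gap_primes_def by auto
  then show "prime q" by auto
next
  case False
  have "list_all (\<lambda>q. q < 131 \<or> 1 < q \<and> q < 131 ^ 2 \<and> (\<forall>p\<in>set trial_primes. \<not> p dvd q)) gap_primes"
    unfolding gap_primes_def trial_primes_def by simp
  moreover assume "q \<in> set gap_primes"
  ultimately have "1 < q \<and> q < 131 ^ 2 \<and> (\<forall>p\<in>set trial_primes. \<not> p dvd q)"
    using False unfolding list_all_iff by blast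
  then show "prime q" using prime_nat_trial_division by blast
qed

text \<open>If \<open>q\<close> lay beyond the interval, then \<open>l \<le> q - P + 3\<close>. The
  gap hypothesis would then force \<open>l ^ 3 < 8 * P ^ 2\<close>, too small for
  \<open>M > P\<close>; the alternative \<open>q \<le> P + 29\<close> suffices because
  \<open>l\<close> is at least 33.\<close>

lemma gap_step:
  fixes P M q l :: nat
  assumes "q \<le> P + 29 \<or> (q - P + 3) ^ 3 < 8 * P ^ 2" "33 \<le> l" "8 * (M - 1) ^ 2 \<le> l ^ 3" "P < M"
  shows "q \<le> M + l - 5"
proof (rule ccontr)
  assume "\<not> ?thesis"
  then have q: "P + l - 3 \<le> q" "P + 29 < q" using assms by auto
  then have "l ^ 3 \<le> (q - P + 3) ^ 3" by (intro power_mono) auto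
  also have "\<dots> < 8 * P ^ 2" using assms(1) q by simp
  also have "\<dots> \<le> 8 * (M - 1) ^ 2" using assms(4) by (intro mult_le_mono power_mono) auto
  finally show False using assms(3) by simp
qed

lemma gap_primes_chain:
  fixes l M P :: nat
  assumes "33 \<le> l" "8 * (M - 1) ^ 2 \<le> l ^ 3"
    "successively (\<lambda>P q. q \<le> P + 29 \<or> (q - P + 3) ^ 3 < 8 * P ^ 2) (P # qs)" "P < M" "M \<le> last (P # qs)"
  shows "\<exists>q\<in>set qs. M \<le> q \<and> q \<le> M + l - 5"
  using assms(3-5)
proof (induction qs arbitrary: P)
  case (Cons q qs)
  show ?case
  proof (cases "M \<le> q")
    case True
    then show ?thesis using gap_step[OF _ assms(1,2) Cons.prems(2), of q] Cons.prems(1) by auto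
  next
    case False
    then show ?thesis using Cons.IH[of q] Cons.prems by auto
  qed
qed simp

text \<open>The interval has only \<open>l - 4\<close> members because it will start up to 4 places
  after the beginning of a window of length \<open>l\<close>.\<close>

lemma prime_in_short_interval:
  fixes l M :: nat
  assumes "33 \<le> l" "8 * (M - 1) ^ 2 \<le> l ^ 3" "33 < M" "M \<le> 16633"
  shows "\<exists>q. prime q \<and> M \<le> q \<and> q \<le> M + l - 5"
proof -
  have "successively (\<lambda>P q. q \<le> P + 29 \<or> (q - P + 3) ^ 3 < 8 * P ^ 2) (33 # gap_primes)"
    unfolding gap_primes_def by simp
  moreover have "M \<le> last (33 # gap_primes)" using assms(4) unfolding gap_primes_def by simp
  ultimately show ?thesis using gap_primes_chain[OF assms(1,2) _ assms(3)] prime_gap_primes by blast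
qed

text \<open>The range stops at 89, since the next prime is 97.\<close>

lemma prime_within_6:
  assumes "7 \<le> M" "M \<le> (89::nat)"
  shows "\<exists>q. prime q \<and> M \<le> q \<and> q \<le> M + 6"
proof -
  let ?P = "[7, 13, 19, 23, 29, 31, 37, 43, 47, 53, 59, 61, 67, 73, 79, 83, 89 :: nat]"
  have "\<forall>q\<in>set ?P. prime q" by simp
  moreover have "\<exists>q\<in>set ?P. M \<le> q \<and> q \<le> M + 6" using assms by simp presburger
  ultimately show ?thesis by blast
qed

section \<open>Sylvester's theorem in a slightly extended range\<close>

lemma add_one_power_ge: "a ^ n * a + n * a ^ n \<le> (a + 1) ^ n * a" for a n :: nat
proof (induction n)
  case (Suc n)
  have "a ^ Suc n * a + Suc n * a ^ Suc n \<le> (a ^ n * a + n * a ^ n) * (a + 1)"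
    by (simp add: algebra_simps)
  also have "\<dots> \<le> (a + 1) ^ n * a * (a + 1)" using Suc by (rule mult_le_mono1)
  finally show ?case by (simp add: algebra_simps)
qed simp

text \<open>The induction step uses \<open>2 * l ^ l \<le> (l + 1) ^ l\<close>, an instance of
  Bernoulli's inequality. At 6 the two sides are 46080 and 46656.\<close>

lemma two_power_fact_le: "6 \<le> l \<Longrightarrow> 2 ^ l * fact l \<le> (l ^ l :: nat)"
proof (induction l rule: dec_induct)
  case base
  show ?case by (simp add: fact_numeral)
next
  case (step l)
  have "2 * l ^ l * l = l ^ l * l + l * l ^ l" by simp
  also have "\<dots> \<le> (l + 1) ^ l * l" by (rule add_one_power_ge)
  finally have "2 * l ^ l * l \<le> (l + 1) ^ l * l" .
  then have *: "2 * l ^ l \<le> (l + 1) ^ l" by (rule mult_right_le_imp_le) (use step.hyps in simp)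
  have "2 ^ Suc l * fact (Suc l) = 2 * (2 ^ l * fact l) * (l + 1)" by (simp add: algebra_simps)
  also have "\<dots> \<le> 2 * l ^ l * (l + 1)" using step.IH by (intro mult_le_mono) auto
  also have "\<dots> \<le> (l + 1) ^ l * (l + 1)" using * by (rule mult_le_mono1)
  also have "\<dots> = Suc l ^ Suc l" by simp
  finally show ?case .
qed

text \<open>With at most \<open>l / 3\<close> primes up to \<open>l\<close>, Erdos's bound gives
  \<open>N ^ (2 * l) \<le> (fact l) ^ 3\<close>. Since \<open>fact l\<close> is at most the
  \<open>l\<close>-th power of \<open>l / 2\<close>, taking \<open>l\<close>-th roots
  finishes.\<close>

lemma smooth_window_cubic_bound:
  fixes l N :: nat
  assumes "33 \<le> l" "N > 0"
    and smooth: "\<And>p t. prime p \<Longrightarrow> t \<in> {N..<N + l} \<Longrightarrow> p dvd t \<Longrightarrow> p \<le> l"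
  shows "8 * N ^ 2 \<le> l ^ 3"
proof -
  have pi: "2 * l \<le> 3 * (l - prime_count l)" using prime_count_le_third[OF assms(1)] by simp
  have "(N ^ 2) ^ l = N ^ (2 * l)" by (simp add: power_mult)
  also have "\<dots> \<le> N ^ (3 * (l - prime_count l))" using assms pi by (intro power_increasing) auto
  also have "\<dots> = (N ^ (l - prime_count l)) ^ 3" by (simp add: power_mult mult.commute[of 3])
  also have "\<dots> \<le> (fact (l - 1)) ^ 3" using assms by (intro power_mono smooth_window_bound) auto
  also have "\<dots> \<le> (fact l) ^ 3" by (intro power_mono fact_mono) auto
  finally have "(N ^ 2) ^ l \<le> (fact l) ^ 3" .
  then have "(2 ^ l) ^ 3 * (N ^ 2) ^ l \<le> (2 ^ l) ^ 3 * (fact l) ^ 3" by (rule mult_le_mono2)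
  moreover have "(8::nat) ^ l = (2 ^ l) ^ 3"
    using power_mult[of "2::nat" 3 l] power_mult[of "2::nat" l 3] by (simp add: mult.commute)
  ultimately have "(8 * N ^ 2) ^ l \<le> (2 ^ l * fact l) ^ 3" by (simp only: power_mult_distrib)
  also have "\<dots> \<le> (l ^ l) ^ 3" using assms by (intro power_mono two_power_fact_le) auto
  also have "\<dots> = (l ^ 3) ^ l" by (simp add: mult.commute flip: power_mult)
  finally show ?thesis using assms(1) power_mono_iff[of "8 * N ^ 2" "l ^ 3" l] by simp
qed

lemma large_window_not_smooth:
  fixes l N :: nat
  assumes l: "1300 \<le> l" and N: "l + 1 \<le> N + 4" and bound: "8 * N ^ 2 \<le> l ^ 3"
  shows "\<exists>p t. prime p \<and> l < p \<and> t \<in> {N..<N + l} \<and> p dvd t"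
proof -
  \<comment> \<open>The cap \<open>N - 1\<close> secures \<open>2 * k \<le> n\<close>. It costs at
    most 4, so a prime above \<open>k + 4\<close> is still above \<open>l\<close>.\<close>
  define k where "k = min l (N - 1)"
  define n where "n = N + l - 1"
  have k: "1296 \<le> k" "2 * k \<le> n" "l \<le> k + 4" using l N by (auto simp: k_def n_def)
  have "8 * (n - k + 1) ^ 2 \<le> k ^ 3"
  proof (cases "l < N")
    case True
    then show ?thesis using bound l by (simp add: k_def n_def)
  next
    case False
    then have "n - k + 1 \<le> k + 5" using N l by (auto simp: k_def n_def)
    then have "8 * (n - k + 1) ^ 2 \<le> 8 * (2 * k) ^ 2" using k by (intro mult_le_mono power_mono) auto
    also have "\<dots> = 32 * k ^ 2" by (simp add: power2_eq_square)
    also have "\<dots> \<le> k * k ^ 2" using k by (intro mult_le_mono) auto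
    finally show ?thesis by (simp add: power3_eq_cube power2_eq_square)
  qed
  then obtain p where p: "prime p" "k + 4 < p" "p dvd (n choose k)"
    using large_prime_divides_binomial k by blast
  have "p dvd \<Prod>{n - k + 1..<n - k + 1 + k}"
    using p(3) k by (subst prod_window_eq_fact_mult_binomial) auto
  then obtain t where "t \<in> {n - k + 1..<n - k + 1 + k}" "p dvd t"
    using p(1) prime_dvd_prod_iff[OF finite_atLeastLessThan, of p "\<lambda>x. x"] by blast
  moreover have "n - k + 1 \<ge> N" "n - k + 1 + k = N + l" using l N by (auto simp: k_def n_def)
  ultimately show ?thesis using p k(3) by (intro exI[of _ p] exI[of _ t]) auto
qed

text \<open>Here \<open>3 * (l - prime_count l)\<close> is at least \<open>2 * l - 5\<close>, so
  Erdos's bound with \<open>N \<ge> 90\<close> contradicts a finite table of factorials. The value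
  89 is the end of the range of \<open>prime_within_6\<close>.\<close>

lemma small_smooth_window_bound:
  fixes l N :: nat
  assumes "7 \<le> l" "l \<le> 32" "N > 0"
    and smooth: "\<And>p t. prime p \<Longrightarrow> t \<in> {N..<N + l} \<Longrightarrow> p dvd t \<Longrightarrow> p \<le> l"
  shows "N \<le> 89"
proof (rule ccontr)
  assume "\<not> N \<le> 89"
  then have "(90::nat) ^ (2 * l - 5) \<le> N ^ (2 * l - 5)" by (intro power_mono) auto
  also have "\<dots> \<le> N ^ (3 * (l - prime_count l))"
    using assms prime_count_le[of l] by (intro power_increasing) auto
  also have "\<dots> = (N ^ (l - prime_count l)) ^ 3" by (simp add: power_mult mult.commute[of 3])
  also have "\<dots> \<le> (fact (l - 1)) ^ 3" using assms by (intro power_mono smooth_window_bound) auto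
  finally have le: "(90::nat) ^ (2 * l - 5) \<le> (fact (l - 1)) ^ 3" .
  have "list_all (\<lambda>l. (fact (l - 1)) ^ 3 < (90::nat) ^ (2 * l - 5)) [7..<33]"
    by (simp add: upt_rec_numeral fact_numeral)
  then have "\<forall>l\<in>{7..<33}. (fact (l - 1)) ^ 3 < (90::nat) ^ (2 * l - 5)" by (simp only: list_all_iff set_upt)
  then have "(fact (l - 1)) ^ 3 < (90::nat) ^ (2 * l - 5)" by (rule bspec) (use assms in simp)
  with leD[OF le] show False by (rule notE)
qed

text \<open>Sylvester's theorem is the case \<open>N > l\<close>. Starting up to
  \<open>min 4 (l div 2)\<close> earlier is what a window of \<open>k + \<alpha>\<close> integers
  from \<open>m - k + 1\<close> on requires when \<open>\<alpha> \<le> k\<close>. Windows of length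
  at least 33 fall to the prime table or, from 1300 on, to the binomial estimate; shorter ones are
  met by explicit primes or by Erdos's bound.\<close>

theorem window_has_large_prime_factor:
  fixes l N :: nat
  assumes l: "1 \<le> l" and N: "1 \<le> N" "l + 1 \<le> N + min 4 (l div 2)"
  shows "\<exists>p t. prime p \<and> l < p \<and> t \<in> {N..<N + l} \<and> p dvd t"
proof (rule ccontr)
  assume no: "\<not> ?thesis"
  then have smooth: "p \<le> l" if "prime p" "t \<in> {N..<N + l}" "p dvd t" for p t
    using that by (meson not_le)
  have no_prime: "\<not> (l < q \<and> N \<le> q \<and> q < N + l)" if "prime q" for q
    using smooth[OF that, of q] by auto
  note bound = smooth_window_bound[OF _ _ smooth]
  consider "l \<ge> 33" | "7 \<le> l" "l \<le> 32" | "l = 1" | "l = 2" | "l = 3" | "l = 4" | "l = 5" | "l = 6"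
    using l by linarith
  then show False
  proof cases
    case 1
    have b: "8 * N ^ 2 \<le> l ^ 3" by (rule smooth_window_cubic_bound[OF 1 _ smooth]) (use N in auto)
    show False
    proof (cases "l < 1300")
      case True
      \<comment> \<open>Any prime from \<open>M\<close> up to the end of the window would exceed
        \<open>l\<close>.\<close>
      define M where "M = max N (l + 1)"
      have M: "8 * (M - 1) ^ 2 \<le> l ^ 3"
      proof (cases "N \<le> l")
        case True
        have "8 * l ^ 2 \<le> l * l ^ 2" using 1 by (intro mult_le_mono) auto
        then show ?thesis using True by (simp add: M_def power3_eq_cube power2_eq_square)
      next
        case False
        have "(M - 1) ^ 2 \<le> N ^ 2" using False by (intro power_mono) (auto simp: M_def)
        then show ?thesis using b by linarith
      qed
      have "M \<le> 16633"
      \<comment> \<open>For \<open>l < 1300\<close> the cubic bound keeps \<open>M\<close> within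
        the reach of \<open>gap_primes\<close>.\<close>
      proof (rule ccontr)
        assume "\<not> M \<le> 16633"
        then have "8 * 16633 ^ 2 \<le> 8 * (M - 1) ^ 2" by (intro mult_le_mono power_mono) auto
        also have "\<dots> \<le> l ^ 3" by (rule M)
        also have "\<dots> \<le> 1300 ^ 3" using True by (intro power_mono) auto
        finally show False by simp
      qed
      moreover have "33 < M" using 1 unfolding M_def by linarith
      ultimately obtain q where "prime q" "M \<le> q" "q \<le> M + l - 5"
        using prime_in_short_interval[OF 1 M] by blast
      moreover have "M \<le> N + 4" using N by (auto simp: M_def)
      ultimately show False using no_prime[of q] 1 by (auto simp: M_def)
    next
      case False
      then show False using large_window_not_smooth[of l N] N b no by auto
    qed
  next
    case 2
    have b: "N \<le> 89" by (rule small_smooth_window_bound[OF 2 _ smooth]) (use N in auto)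
    show False
    proof (cases "N \<le> l \<and> l \<le> 10")
      case True
      \<comment> \<open>The seven numbers from \<open>l + 1\<close> on may overrun the window here,
        so the prime 11 is used directly.\<close>
      then have "l < 11 \<and> N \<le> 11 \<and> 11 < N + l" using N 2 by auto
      then show False using no_prime[of 11] by simp
    next
      case False
      define M where "M = max N (l + 1)"
      have "7 \<le> M" "M \<le> 89" using b 2 by (auto simp: M_def)
      then obtain q where "prime q" "M \<le> q" "q \<le> M + 6" using prime_within_6 by blast
      then show False using no_prime[of q] False N 2 by (auto simp: M_def max_def split: if_splits)
    qed
  next
    case 3
    then obtain p where "prime p" "p dvd N" using prime_factor_nat[of N] N by auto
    then show False using smooth[of p N] 3 prime_gt_1_nat[of p] by auto
  next
    case 4
    define t where "t = (if odd N then N else N + 1)"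
    have t: "odd t" "t \<in> {N..<N + l}" "t \<noteq> 1" using 4 N by (auto simp: t_def)
    then obtain p where p: "prime p" "p dvd t" using prime_factor_nat[of t] by auto
    then have "p \<le> 2" using smooth[OF p(1) t(2) p(2)] 4 by simp
    then have "p = 2" using prime_ge_2_nat[OF p(1)] by simp
    then show False using p(2) t(1) by simp
  next
    case 5
    then have "N ^ (3 - prime_count 3) \<le> 2" using bound N by (simp add: fact_numeral)
    moreover have "N ^ 1 \<le> N ^ (3 - prime_count 3)" using prime_count_le[of 3] N by (intro power_increasing) auto
    ultimately show False using N 5 by auto
  next
    case 6
    then have "N ^ (4 - prime_count 4) \<le> 6" using bound N by (simp add: fact_numeral)
    moreover have "N ^ 1 \<le> N ^ (4 - prime_count 4)" using prime_count_le[of 4] N by (intro power_increasing) auto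
    ultimately have "N \<in> {3, 4, 5, 6}" using N 6 by auto
    then show False using no_prime[of 5] no_prime[of 7] 6 by auto
  next
    case 7
    then have "N ^ (5 - prime_count 5) \<le> 24" using bound N by (simp add: fact_numeral)
    moreover have "N ^ 2 \<le> N ^ (5 - prime_count 5)" using prime_count_le[of 5] N by (intro power_increasing) auto
    ultimately have "N ^ 2 < 5 ^ 2" by simp
    then have "N < 5" by (rule power_less_imp_less_base) simp
    then show False using no_prime[of 7] 7 N by auto
  next
    case 8
    then have "N ^ (6 - prime_count 6) \<le> 120" using bound N by (simp add: fact_numeral)
    moreover have "N ^ 3 \<le> N ^ (6 - prime_count 6)" using prime_count_le[of 6] N by (intro power_increasing) auto
    ultimately have "N ^ 3 < 5 ^ 3" by simp
    then have "N < 5" by (rule power_less_imp_less_base) simp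
    then show False using no_prime[of 7] 8 N by auto
  qed
qed

section \<open>Valuations of the Laguerre coefficients\<close>

lemma fact_mult_prod_shift:
  "j \<le> m \<Longrightarrow> fact (j + \<alpha>) * (\<Prod>i = j + 1..m. i + \<alpha>) = (fact (m + \<alpha>) :: nat)"
proof (induction m rule: dec_induct)
  case (step m)
  have "{j + 1..Suc m} = insert (Suc m) {j + 1..m}" using step.hyps by auto
  then show ?case using step.IH by (simp add: algebra_simps)
qed simp

lemma laguerre_coeff_fact:
  "j \<le> m \<Longrightarrow> laguerre_coeff m \<alpha> j * fact (j + \<alpha>) = (m choose j) * fact (m + \<alpha>)"
  using fact_mult_prod_shift[of j m \<alpha>] by (simp add: laguerre_coeff_def ac_simps)

text \<open>The defining form displays the factors \<open>i + \<alpha>\<close>, this one the factors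
  \<open>i\<close>. Together they make a prime dividing either kind divide all coefficients of lower
  index.\<close>

lemma laguerre_coeff_eq:
  assumes "j \<le> m"
  shows "laguerre_coeff m \<alpha> j = (m + \<alpha> choose (j + \<alpha>)) * (\<Prod>i = j + 1..m. i)"
proof -
  have "(fact (m - j) * fact (j + \<alpha>) * fact j) * laguerre_coeff m \<alpha> j =
      (fact j * fact (m - j) * (m choose j)) * fact (m + \<alpha>)"
    using laguerre_coeff_fact[OF assms, of \<alpha>] by (simp add: ac_simps)
  also have "\<dots> = fact m * (fact (j + \<alpha>) * fact (m - j) * (m + \<alpha> choose (j + \<alpha>)))"
    using binomial_fact_lemma[OF assms] binomial_fact_lemma[of "j + \<alpha>" "m + \<alpha>"] assms by simp
  also have "(fact m :: nat) = fact j * (\<Prod>i = j + 1..m. i)"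
    using fact_mult_prod_shift[OF assms, of 0] by simp
  finally have "(fact (m - j) * fact (j + \<alpha>) * fact j) * laguerre_coeff m \<alpha> j =
      (fact (m - j) * fact (j + \<alpha>) * fact j) * ((m + \<alpha> choose (j + \<alpha>)) * (\<Prod>i = j + 1..m. i))"
    by (simp add: ac_simps)
  then show ?thesis by simp
qed

lemma laguerre_coeff_pos: "j \<le> m \<Longrightarrow> laguerre_coeff m \<alpha> j > 0"
  by (simp add: laguerre_coeff_eq prod_pos)

lemma laguerre_coeff_dvd:
  assumes "j < i" "i \<le> m" "p dvd i \<or> p dvd i + \<alpha>"
  shows "p dvd laguerre_coeff m \<alpha> j"
proof -
  have i: "i \<in> {j + 1..m}" using assms by auto
  from assms(3) show ?thesis
  proof
    assume "p dvd i"
    also have "i dvd (\<Prod>i = j + 1..m. i)" by (rule dvd_prodI[OF _ i]) simp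
    finally show ?thesis using assms by (simp add: laguerre_coeff_eq)
  next
    assume "p dvd i + \<alpha>"
    also have "i + \<alpha> dvd (\<Prod>i = j + 1..m. i + \<alpha>)" by (rule dvd_prodI[OF _ i]) simp
    finally show ?thesis by (simp add: laguerre_coeff_def)
  qed
qed

text \<open>Both \<open>laguerre_coeff m \<alpha> 0 * fact \<alpha>\<close> times the binomial
  coefficient and \<open>laguerre_coeff m \<alpha> j * fact (j + \<alpha>)\<close> equal
  \<open>(m choose j) * fact (m + \<alpha>)\<close>. This turns slope conditions into statements
  about factorials.\<close>

lemma multiplicity_laguerre_coeff_0:
  fixes p :: nat
  assumes p: "prime p" and j: "j \<le> m"
  shows "multiplicity p (laguerre_coeff m \<alpha> 0) + multiplicity p (fact \<alpha> :: nat) + multiplicity p (m choose j) =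
      multiplicity p (laguerre_coeff m \<alpha> j) + multiplicity p (fact (j + \<alpha>) :: nat)"
proof -
  have "laguerre_coeff m \<alpha> 0 * fact \<alpha> * (m choose j) = laguerre_coeff m \<alpha> j * fact (j + \<alpha>)"
    using laguerre_coeff_fact[of 0 m \<alpha>] laguerre_coeff_fact[OF j, of \<alpha>] by simp
  then have "multiplicity p (laguerre_coeff m \<alpha> 0 * fact \<alpha> * (m choose j)) =
      multiplicity p (laguerre_coeff m \<alpha> j * fact (j + \<alpha>))" by (rule arg_cong)
  then show ?thesis using j laguerre_coeff_pos[of 0 m \<alpha>] laguerre_coeff_pos[OF j, of \<alpha>]
    by (simp add: multiplicity_mult_nat[OF p])
qed

text \<open>Replaces \<open>fact (j + \<alpha>)\<close> by the smaller \<open>fact j\<close>, at the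
  price of a binomial coefficient independent of \<open>j\<close>. It is useful when
  \<open>p\<close> does not divide that binomial coefficient.\<close>

lemma multiplicity_laguerre_coeff_0':
  fixes p :: nat
  assumes p: "prime p" and j: "j \<le> m"
  shows "multiplicity p (laguerre_coeff m \<alpha> 0) \<le>
      multiplicity p (laguerre_coeff m \<alpha> j) + multiplicity p (fact j :: nat) + multiplicity p (m + \<alpha> choose \<alpha>)"
proof -
  have "laguerre_coeff m \<alpha> 0 = (m + \<alpha> choose \<alpha>) * fact m"
    using laguerre_coeff_eq[of 0 m \<alpha>] by (simp add: fact_prod)
  also have "fact m = fact j * (\<Prod>i = j + 1..m. i)" using fact_mult_prod_shift[OF j, of 0] by simp
  also have "(m + \<alpha> choose \<alpha>) * \<dots> dvd laguerre_coeff m \<alpha> j * fact j * (m + \<alpha> choose \<alpha>)"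
    by (simp add: laguerre_coeff_eq[OF j] mult_dvd_mono ac_simps)
  finally have "multiplicity p (laguerre_coeff m \<alpha> 0) \<le> multiplicity p (laguerre_coeff m \<alpha> j * fact j * (m + \<alpha> choose \<alpha>))"
    using laguerre_coeff_pos[OF j] by (intro multiplicity_mono_nat) auto
  then show ?thesis using laguerre_coeff_pos[OF j, of \<alpha>] by (simp add: multiplicity_mult_nat[OF p])
qed

text \<open>The Newton polygon at \<open>p\<close> rules out a factor of degree \<open>k * degree \<phi>\<close>: its horizontal edge is
  shorter than \<open>k\<close> and all its slopes are below \<open>1 / k\<close>.\<close>
definition excluding_prime :: "nat \<Rightarrow> nat \<Rightarrow> nat \<Rightarrow> nat \<Rightarrow> bool" where
  "excluding_prime m \<alpha> k p \<longleftrightarrow> prime p \<and> (\<forall>j\<le>m - k. p dvd laguerre_coeff m \<alpha> j) \<and>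
    (\<forall>j. 1 \<le> j \<longrightarrow> j \<le> m \<longrightarrow>
      k * multiplicity p (laguerre_coeff m \<alpha> 0) < k * multiplicity p (laguerre_coeff m \<alpha> j) + j)"

lemma excluding_primeI:
  assumes "prime p" "m - k < i" "i \<le> m" "p dvd i \<or> p dvd i + \<alpha>"
    and slope: "\<And>j. 1 \<le> j \<Longrightarrow> j \<le> m \<Longrightarrow>
      k * multiplicity p (fact (j + \<alpha>) :: nat) < k * multiplicity p (fact \<alpha> :: nat) + k * multiplicity p (m choose j) + j"
  shows "excluding_prime m \<alpha> k p"
  unfolding excluding_prime_def
proof (intro conjI allI impI)
  fix j assume "j \<le> m - k"
  then show "p dvd laguerre_coeff m \<alpha> j" using assms(2-4) by (intro laguerre_coeff_dvd[of j i]) auto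
next
  fix j assume j: "1 \<le> j" "j \<le> m"
  have "k * multiplicity p (laguerre_coeff m \<alpha> 0) + k * multiplicity p (fact \<alpha> :: nat) + k * multiplicity p (m choose j) =
      k * multiplicity p (laguerre_coeff m \<alpha> j) + k * multiplicity p (fact (j + \<alpha>) :: nat)"
    using multiplicity_laguerre_coeff_0[OF assms(1) j(2), of \<alpha>] by (metis distrib_left)
  then show "k * multiplicity p (laguerre_coeff m \<alpha> 0) < k * multiplicity p (laguerre_coeff m \<alpha> j) + j"
    using slope[OF j] by linarith
qed fact

text \<open>Legendre's bound with \<open>p - 1 \<ge> k + \<alpha>\<close> gives
  \<open>(k + \<alpha>) * v < j + \<alpha>\<close> for the valuation \<open>v\<close> of
  \<open>fact (j + \<alpha>)\<close>. If \<open>v\<close> is positive, the part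
  \<open>\<alpha> * v\<close> absorbs the \<open>\<alpha>\<close> on the right.\<close>

lemma excluding_prime_large:
  assumes p: "prime p" "k + \<alpha> < p" and i: "m - k < i" "i \<le> m" "p dvd i \<or> p dvd i + \<alpha>"
  shows "excluding_prime m \<alpha> k p"
proof (rule excluding_primeI[OF p(1) i])
  fix j :: nat assume j: "1 \<le> j"
  let ?v = "multiplicity p (fact (j + \<alpha>) :: nat)"
  have "k * ?v < j"
  proof (cases "?v = 0")
    case False
    have "(k + \<alpha>) * ?v \<le> (p - 1) * ?v" using p(2) by (intro mult_le_mono1) simp
    also have "\<dots> < j + \<alpha>" using multiplicity_fact_less[OF p(1), of "j + \<alpha>"] j by simp
    finally have "k * ?v + \<alpha> * ?v < j + \<alpha>" by (simp add: distrib_right)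
    moreover have "\<alpha> * 1 \<le> \<alpha> * ?v" using False by (intro mult_le_mono2) simp
    ultimately show ?thesis by linarith
  qed (use j in simp)
  then show "k * ?v < k * multiplicity p (fact \<alpha> :: nat) + k * multiplicity p (m choose j) + j" by simp
qed

text \<open>Admits primes between \<open>k\<close> and \<open>k + \<alpha>\<close>. The condition
  \<open>i + \<alpha> < p\<close> keeps \<open>p\<close> from dividing any of
  \<open>m + 1, ..., m + \<alpha>\<close>, so the binomial coefficient of
  \<open>m + \<alpha>\<close> over \<open>\<alpha>\<close> is prime to \<open>p\<close> and only
  \<open>fact j\<close> matters for the slopes.\<close>

lemma excluding_prime_top:
  assumes p: "prime p" "k < p" and i: "i < k" "k \<le> m" "p dvd m - i" "i + \<alpha> < p"
  shows "excluding_prime m \<alpha> k p"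
  unfolding excluding_prime_def
proof (intro conjI allI impI)
  fix j assume "j \<le> m - k"
  then show "p dvd laguerre_coeff m \<alpha> j"
    using i by (intro laguerre_coeff_dvd[of j "m - i"]) auto
next
  fix j assume j: "1 \<le> j" "j \<le> m"
  have ndvd: "\<not> p dvd m + s" if "s \<in> {1..\<alpha>}" for s
  proof
    assume "p dvd m + s"
    then have "p dvd (m + s) - (m - i)" using i(3) by (rule dvd_diff_nat)
    then have "p dvd s + i" using i(1,2) by simp
    then have "p \<le> s + i" using that by (intro dvd_imp_le) auto
    then show False using i(4) that by simp
  qed
  have "(\<Prod>s\<in>{1..\<alpha>}. m + s) = fact \<alpha> * (m + \<alpha> choose \<alpha>)"
  proof -
    have "fact m * (\<Prod>s\<in>{1..\<alpha>}. m + s) = (fact m * fact \<alpha> * (m + \<alpha> choose \<alpha>) :: nat)"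
      using fact_mult_prod_shift[of 0 \<alpha> m] binomial_fact_lemma[of \<alpha> "m + \<alpha>"] by (simp add: ac_simps)
    then show ?thesis by simp
  qed
  moreover have "\<not> p dvd (\<Prod>s\<in>{1..\<alpha>}. m + s)" using ndvd p(1) by (subst prime_dvd_prod_iff) auto
  ultimately have "\<not> p dvd (m + \<alpha> choose \<alpha>)" by (metis dvd_mult)
  then have v0: "multiplicity p (m + \<alpha> choose \<alpha>) = 0" by (rule not_dvd_imp_multiplicity_0)
  have "k * multiplicity p (fact j :: nat) \<le> (p - 1) * multiplicity p (fact j :: nat)"
    using p(2) by (intro mult_le_mono1) simp
  also have "\<dots> < j" using multiplicity_fact_less[OF p(1)] j by simp
  finally have "k * multiplicity p (fact j :: nat) < j" .
  moreover have "k * multiplicity p (laguerre_coeff m \<alpha> 0) \<le>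
      k * (multiplicity p (laguerre_coeff m \<alpha> j) + multiplicity p (fact j :: nat))"
    using multiplicity_laguerre_coeff_0'[OF p(1) j(2), of \<alpha>] v0 by (intro mult_le_mono2) simp
  ultimately show "k * multiplicity p (laguerre_coeff m \<alpha> 0) < k * multiplicity p (laguerre_coeff m \<alpha> j) + j"
    by (simp add: distrib_left)
qed fact

lemma excluding_prime_exists_of_ge:
  assumes "1 \<le> k" "2 * k \<le> m" "\<alpha> \<le> k" "\<alpha> \<le> 4"
  shows "\<exists>p. excluding_prime m \<alpha> k p"
proof -
  have "k + \<alpha> + 1 \<le> m - k + 1 + min 4 ((k + \<alpha>) div 2)" using assms by auto
  then obtain p t where p: "prime p" "k + \<alpha> < p" and t: "t \<in> {m - k + 1..<m - k + 1 + (k + \<alpha>)}" "p dvd t"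
    using window_has_large_prime_factor[of "k + \<alpha>" "m - k + 1"] assms by auto
  show ?thesis
  proof (cases "t \<le> m")
    case True
    then show ?thesis using excluding_prime_large[OF p, of m t] t by auto
  next
    case False
    \<comment> \<open>Since \<open>t > m\<close> and \<open>\<alpha> \<le> k\<close>, the index
      \<open>t - \<alpha>\<close> is still above \<open>m - k\<close>.\<close>
    then have "t - \<alpha> + \<alpha> = t" "m - k < t - \<alpha>" "t - \<alpha> \<le> m" using assms t by auto
    then show ?thesis using excluding_prime_large[OF p, of m "t - \<alpha>"] t by auto
  qed
qed

section \<open>The primes 2 and 3 in the cases where k is less than \<alpha>\<close>

lemma multiplicity_fact_steps:
  fixes p :: nat
  assumes "prime p"
  shows "multiplicity p (fact (j + 1) :: nat) = multiplicity p (j + 1) + multiplicity p (fact j :: nat)"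
    "multiplicity p (fact (j + 2) :: nat) = multiplicity p (j + 2) + multiplicity p (fact (j + 1) :: nat)"
    "multiplicity p (fact (j + 3) :: nat) = multiplicity p (j + 3) + multiplicity p (fact (j + 2) :: nat)"
    "multiplicity p (fact (j + 4) :: nat) = multiplicity p (j + 4) + multiplicity p (fact (j + 3) :: nat)"
proof -
  have *: "multiplicity p (fact (Suc n) :: nat) = multiplicity p (Suc n) + multiplicity p (fact n :: nat)" for n
    unfolding fact_Suc of_nat_id by (rule multiplicity_mult_nat[OF assms]) simp_all
  show "multiplicity p (fact (j + 1) :: nat) = multiplicity p (j + 1) + multiplicity p (fact j :: nat)"
    "multiplicity p (fact (j + 2) :: nat) = multiplicity p (j + 2) + multiplicity p (fact (j + 1) :: nat)"
    "multiplicity p (fact (j + 3) :: nat) = multiplicity p (j + 3) + multiplicity p (fact (j + 2) :: nat)"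
    "multiplicity p (fact (j + 4) :: nat) = multiplicity p (j + 4) + multiplicity p (fact (j + 3) :: nat)"
    using *[of j] *[of "j + 1"] *[of "j + 2"] *[of "j + 3"] by (simp_all add: numeral_eq_Suc del: fact_Suc)
qed

text \<open>From \<open>j * (m choose j) = m * (m - 1 choose (j - 1))\<close>: a power dividing the
  right-hand side but not \<open>j\<close> must share a factor with the binomial
  coefficient.\<close>

lemma prime_dvd_binomial_of_power_dvd:
  fixes p :: nat
  assumes p: "prime p" and "p ^ e dvd m" "\<not> p ^ e dvd j"
  shows "p dvd (m choose j)"
proof (rule ccontr)
  assume "\<not> ?thesis"
  then have "coprime (p ^ e) (m choose j)" using p by (simp add: prime_imp_coprime)
  moreover have "j > 0" using assms(3) by (auto intro!: Nat.gr0I)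
  then have "p ^ e dvd j * (m choose j)" using assms(2) by (simp add: times_binomial_minus1_eq)
  ultimately show False using assms(3) by (simp add: coprime_dvd_mult_left_iff)
qed

text \<open>In Vandermonde's sum each term either vanishes or contains a binomial coefficient
  covered by the previous lemma.\<close>

lemma prime_dvd_binomial_add:
  fixes p :: nat
  assumes p: "prime p" and "p ^ e dvd m" "s < j" "\<And>i. i \<le> s \<Longrightarrow> \<not> p ^ e dvd j - i"
  shows "p dvd (m + s choose j)"
proof -
  have "p dvd (m choose i) * (s choose (j - i))" if "i \<le> j" for i
  proof (cases "j - i \<le> s")
    case True
    then have "\<not> p ^ e dvd i" using assms(4)[of "j - i"] that by simp
    then show ?thesis using prime_dvd_binomial_of_power_dvd[OF p assms(2)] by simp
  qed (simp add: binomial_eq_0)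
  then have "p dvd (\<Sum>i\<le>j. (m choose i) * (s choose (j - i)))" by (intro dvd_sum) auto
  then show ?thesis by (simp only: vandermonde)
qed

lemma multiplicity_ge_1: "prime p \<Longrightarrow> p dvd x \<Longrightarrow> x > 0 \<Longrightarrow> 1 \<le> multiplicity p (x::nat)"
  by (simp add: Suc_le_eq prime_multiplicity_gt_zero_iff)

lemma multiplicity_exact:
  fixes p :: nat
  shows "p ^ e dvd x \<Longrightarrow> \<not> p ^ Suc e dvd x \<Longrightarrow> multiplicity p x = e"
  by (rule multiplicity_eqI)

text \<open>Legendre's bound for \<open>fact (j + 2)\<close> is too weak by one. For odd
  \<open>j\<close> and for multiples of 4 the last factors have small valuation; otherwise 4 divides
  \<open>m\<close> but not \<open>j\<close>, so the binomial coefficient is even.\<close>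

lemma excluding_2_alpha_2:
  assumes "4 dvd m" "m > 0"
  shows "excluding_prime m 2 1 2"
proof (rule excluding_primeI[of 2 m 1 m])
  fix j assume j: "1 \<le> j" "j \<le> m"
  let ?v = "\<lambda>x::nat. multiplicity 2 x"
  note steps = multiplicity_fact_steps[OF two_is_prime_nat, of j]
  have b: "?v (fact j) < j" "?v (fact (j + 1)) < j + 1" "?v (fact (j + 2)) < j + 2"
    using multiplicity_fact_less[OF two_is_prime_nat, of j] multiplicity_fact_less[OF two_is_prime_nat, of "j + 1"]
      multiplicity_fact_less[OF two_is_prime_nat, of "j + 2"] j by simp_all
  have "?v (fact (j + 2)) \<le> j + ?v (m choose j)"
  proof -
    consider "odd j" | "4 dvd j" | "even j" "\<not> 4 dvd j" by blast
    then show ?thesis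
    proof cases
      case 1
      then have "?v (j + 2) = 0" by (intro not_dvd_imp_multiplicity_0) simp
      then show ?thesis using steps b by simp
    next
      case 2
      have "?v (j + 2) = 1" by (rule multiplicity_exact; simp; use 2 in presburger)
      moreover have "?v (j + 1) = 0" by (intro not_dvd_imp_multiplicity_0) (use 2 in presburger)
      ultimately show ?thesis using steps b by simp
    next
      case 3
      have "2 dvd (m choose j)"
        by (rule prime_dvd_binomial_of_power_dvd[of 2 2]) (use assms 3 in simp_all)
      then have "1 \<le> ?v (m choose j)" using j by (intro multiplicity_ge_1) auto
      then show ?thesis using b by simp
    qed
  qed
  moreover have "?v (fact 2) = 1" by (rule multiplicity_exact) (simp_all add: fact_numeral)
  ultimately show "1 * ?v (fact (j + 2)) < 1 * ?v (fact 2) + 1 * ?v (m choose j) + j" by simp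
qed (use assms in auto)

text \<open>Again one unit is missing. The last factors supply it unless \<open>j\<close> is 4
  modulo 8, and then \<open>8 dvd m\<close> makes the binomial coefficient even.\<close>

lemma excluding_2_alpha_4:
  assumes "8 dvd m" "m > 0"
  shows "excluding_prime m 4 1 2"
proof (rule excluding_primeI[of 2 m 1 m])
  fix j assume j: "1 \<le> j" "j \<le> m"
  let ?v = "\<lambda>x::nat. multiplicity 2 x"
  note steps = multiplicity_fact_steps[OF two_is_prime_nat, of j]
  have b: "?v (fact j) < j" "?v (fact (j + 2)) < j + 2" "?v (fact (j + 3)) < j + 3" "?v (fact (j + 4)) < j + 4"
    using multiplicity_fact_less[OF two_is_prime_nat, of j]
      multiplicity_fact_less[OF two_is_prime_nat, of "j + 2"] multiplicity_fact_less[OF two_is_prime_nat, of "j + 3"]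
      multiplicity_fact_less[OF two_is_prime_nat, of "j + 4"] j by simp_all
  have "?v (fact (j + 4)) \<le> j + 2 + ?v (m choose j)"
  proof -
    consider "odd j" | "8 dvd j" | "4 dvd j" "\<not> 8 dvd j" | "even j" "\<not> 4 dvd j" by blast
    then show ?thesis
    proof cases
      case 1
      then have "?v (j + 4) = 0" by (intro not_dvd_imp_multiplicity_0) simp
      then show ?thesis using steps b by simp
    next
      case 2
      have "?v (j + 4) = 2" "?v (j + 2) = 1" by (rule multiplicity_exact; simp; use 2 in presburger)+
      moreover have "?v (j + 1) = 0" "?v (j + 3) = 0" by (intro not_dvd_imp_multiplicity_0; use 2 in presburger)+
      ultimately show ?thesis using steps b by simp
    next
      case 3
      have "2 dvd (m choose j)"
        by (rule prime_dvd_binomial_of_power_dvd[of 2 3]) (use assms 3 in simp_all)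
      then have "1 \<le> ?v (m choose j)" using j by (intro multiplicity_ge_1) auto
      then show ?thesis using b by simp
    next
      case 4
      have "?v (j + 4) = 1" by (rule multiplicity_exact; simp; use 4 in presburger)
      moreover have "?v (j + 3) = 0" by (intro not_dvd_imp_multiplicity_0) (use 4 in presburger)
      ultimately show ?thesis using steps b by simp
    qed
  qed
  moreover have "?v (fact 4) = 3" by (rule multiplicity_exact) (simp_all add: fact_numeral)
  ultimately show "1 * ?v (fact (j + 4)) < 1 * ?v (fact 4) + 1 * ?v (m choose j) + j" by simp
qed (use assms in auto)

lemma prime_3_nat: "prime (3::nat)" by simp

lemma multiplicity_3_fact_small: "multiplicity 3 (fact 3 :: nat) = 1" "multiplicity 3 (fact 4 :: nat) = 1"
    "multiplicity 3 (fact 5 :: nat) = 1"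
  by (rule multiplicity_exact; simp add: fact_numeral)+

lemma excluding_3_alpha_3:
  assumes "3 dvd m" "m > 0"
  shows "excluding_prime m 3 1 3"
proof (rule excluding_primeI[of 3 m 1 m])
  fix j assume j: "1 \<le> j" "j \<le> m"
  have "2 * multiplicity 3 (fact (j + 3) :: nat) < j + 3"
    using multiplicity_fact_less[OF prime_3_nat, of "j + 3"] by simp
  then show "1 * multiplicity 3 (fact (j + 3) :: nat) < 1 * multiplicity 3 (fact 3 :: nat) + 1 * multiplicity 3 (m choose j) + j"
    using j multiplicity_3_fact_small by simp
qed (use assms in auto)

lemma excluding_3_alpha_4:
  assumes "3 dvd m \<or> 3 dvd m + 4" "m > 0"
  shows "excluding_prime m 4 1 3"
proof (rule excluding_primeI[of 3 m 1 m])
  fix j assume j: "1 \<le> j" "j \<le> m"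
  have b: "2 * multiplicity 3 (fact (j + 4) :: nat) < j + 4"
    using multiplicity_fact_less[OF prime_3_nat, of "j + 4"] by simp
  have "multiplicity 3 (fact (j + 4) :: nat) < 1 + j"
  proof (cases "j = 1")
    case True
    then show ?thesis using multiplicity_3_fact_small by simp
  qed (use b j in simp)
  then show "1 * multiplicity 3 (fact (j + 4) :: nat) < 1 * multiplicity 3 (fact 4 :: nat) + 1 * multiplicity 3 (m choose j) + j"
    using multiplicity_3_fact_small by simp
qed (use assms in auto)

text \<open>An instance of Lucas's theorem: the second ternary digit of \<open>m\<close> is at most
  1, that of \<open>j\<close> is 2.\<close>

lemma three_dvd_binomial_mod_9:
  assumes "m mod 9 \<in> {0, 1, 3, 4}" "j mod 9 = 6"
  shows "3 dvd (m choose j)"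
proof -
  have j: "6 \<le> j" using assms(2) by presburger
  have "3 dvd (9 * (m div 9) + m mod 9 choose j)"
  proof (rule prime_dvd_binomial_add[of 3 2])
    fix i assume "i \<le> m mod 9"
    then have "i \<le> 4" using assms(1) by auto
    then show "\<not> 3 ^ 2 dvd j - i" using assms(2) j by simp presburger
  qed (use assms j in auto)
  then show ?thesis by simp
qed

lemma three_dvd_binomial_mod_3:
  assumes "m mod 3 \<in> {0, 1}" "j mod 3 = 2"
  shows "3 dvd (m choose j)"
proof -
  have j: "2 \<le> j" using assms(2) by presburger
  have "3 dvd (3 * (m div 3) + m mod 3 choose j)"
  proof (rule prime_dvd_binomial_add[of 3 1])
    fix i assume "i \<le> m mod 3"
    then have "i \<le> 1" using assms(1) by auto
    then show "\<not> 3 ^ 1 dvd j - i" using assms(2) j by simp presburger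
  qed (use assms j in auto)
  then show ?thesis by simp
qed

text \<open>Legendre's bound misses the claim by one. If \<open>j\<close> is not 6 modulo 9, then 9
  does not divide \<open>j + 3\<close>, which suffices; in the remaining class the binomial
  coefficient is divisible by 3.\<close>

lemma multiplicity_3_fact_add_3:
  assumes "m mod 9 \<in> {0, 1, 3, 4}" "1 \<le> j" "j \<le> m"
  shows "2 * multiplicity 3 (fact (j + 3) :: nat) < 2 + 2 * multiplicity 3 (m choose j) + j"
proof -
  let ?v = "\<lambda>x::nat. multiplicity 3 x"
  note steps = multiplicity_fact_steps[OF prime_3_nat, of j]
  have b: "2 * ?v (fact j) < j" "2 * ?v (fact (j + 2)) < j + 2" "2 * ?v (fact (j + 3)) < j + 3"
    using multiplicity_fact_less[OF prime_3_nat, of j] multiplicity_fact_less[OF prime_3_nat, of "j + 2"]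
      multiplicity_fact_less[OF prime_3_nat, of "j + 3"] assms(2) by simp_all
  consider "\<not> 3 dvd j" | "3 dvd j" "j mod 9 \<noteq> 6" | "j mod 9 = 6" by blast
  then show ?thesis
  proof cases
    case 1
    then have "?v (j + 3) = 0" by (intro not_dvd_imp_multiplicity_0) simp
    then show ?thesis using steps b by simp
  next
    case 2
    have "?v (j + 3) = 1" by (rule multiplicity_exact; simp; use 2 in presburger)
    moreover have "?v (j + 1) = 0" "?v (j + 2) = 0" by (intro not_dvd_imp_multiplicity_0; use 2 in presburger)+
    ultimately show ?thesis using steps b by simp
  next
    case 3
    have "1 \<le> ?v (m choose j)" using three_dvd_binomial_mod_9[OF assms(1) 3] assms by (intro multiplicity_ge_1) auto
    then show ?thesis using b by simp
  qed
qed

lemma excluding_3_alpha_3_2: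
  assumes "m mod 9 \<in> {0, 1, 3, 4}" "2 \<le> m"
  shows "excluding_prime m 3 2 3"
proof -
  obtain i where i: "m - 2 < i" "i \<le> m" "3 dvd i"
  proof (cases "3 dvd m")
    case False
    then have "3 dvd m - 1" using assms by auto presburger+
    then show thesis using that[of "m - 1"] assms(2) by simp
  qed (use that[of m] assms(2) in simp)
  show ?thesis
  proof (rule excluding_primeI[OF prime_3_nat i(1,2)])
    fix j assume "1 \<le> j" "j \<le> m"
    then show "2 * multiplicity 3 (fact (j + 3) :: nat) < 2 * multiplicity 3 (fact 3 :: nat) + 2 * multiplicity 3 (m choose j) + j"
      using multiplicity_3_fact_add_3[OF assms(1)] multiplicity_3_fact_small by simp
  qed (use i in simp)
qed

text \<open>The residue of \<open>j\<close> modulo 3 decides: residue 0 reduces to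
  \<open>fact (j + 3)\<close>, residue 1 to \<open>fact (j + 2)\<close>, and for residue 2 the
  binomial coefficient is divisible by 3.\<close>

lemma excluding_3_alpha_4_2:
  assumes "m mod 9 \<in> {0, 1, 3, 4}" "2 \<le> m"
  shows "excluding_prime m 4 2 3"
proof -
  obtain i where i: "m - 2 < i" "i \<le> m" "3 dvd i"
  proof (cases "3 dvd m")
    case False
    then have "3 dvd m - 1" using assms by auto presburger+
    then show thesis using that[of "m - 1"] assms(2) by simp
  qed (use that[of m] assms(2) in simp)
  show ?thesis
  proof (rule excluding_primeI[OF prime_3_nat i(1,2)])
    fix j assume j: "1 \<le> j" "j \<le> m"
    let ?v = "\<lambda>x::nat. multiplicity 3 x"
    note steps = multiplicity_fact_steps[OF prime_3_nat, of j]
    have b: "2 * ?v (fact (j + 2)) < j + 2" "2 * ?v (fact (j + 4)) < j + 4"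
      using multiplicity_fact_less[OF prime_3_nat, of "j + 2"]
        multiplicity_fact_less[OF prime_3_nat, of "j + 4"] by simp_all
    have "2 * ?v (fact (j + 4)) < 2 + 2 * ?v (m choose j) + j"
    proof -
      consider "j mod 3 = 0" | "j mod 3 = 1" | "j mod 3 = 2" by linarith
      then show ?thesis
      proof cases
        case 1
        then have "?v (j + 4) = 0" by (intro not_dvd_imp_multiplicity_0) presburger
        then show ?thesis using steps multiplicity_3_fact_add_3[OF assms(1) j] by simp
      next
        case 2
        then have "?v (j + 4) = 0" "?v (j + 3) = 0" by (intro not_dvd_imp_multiplicity_0; presburger)+
        then show ?thesis using steps b by simp
      next
        case 3
        have "m mod 3 \<in> {0, 1}" using assms(1) by auto presburger+
        then have "1 \<le> ?v (m choose j)" using three_dvd_binomial_mod_3[OF _ 3] j by (intro multiplicity_ge_1) auto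
        then show ?thesis using b by simp
      qed
    qed
    then show "2 * ?v (fact (j + 4)) < 2 * ?v (fact 4) + 2 * ?v (m choose j) + j"
      using multiplicity_3_fact_small by simp
  qed (use i in simp)
qed

section \<open>Smooth neighbours of m in the cases where k is less than \<alpha>\<close>

lemma eq_prime_powers_235:
  fixes n :: nat
  assumes "n > 0" "\<And>q. prime q \<Longrightarrow> q dvd n \<Longrightarrow> q \<in> {2, 3, 5}"
  shows "\<exists>a b c. n = 2 ^ a * 3 ^ b * 5 ^ c"
  using assms
proof (induction n rule: less_induct)
  case (less n)
  show ?case
  proof (cases "n = 1")
    case True
    then show ?thesis by (intro exI[of _ 0]) simp
  next
    case False
    then obtain q where q: "prime q" "q dvd n" using prime_factor_nat by blast
    then obtain k where k: "n = q * k" by blast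
    have "1 < q" using q(1) by (rule prime_gt_1_nat)
    then have "k < n" "k > 0" using k less.prems(1) by auto
    moreover have "r \<in> {2, 3, 5}" if "prime r" "r dvd k" for r using less.prems(2) that k by auto
    ultimately obtain a b c where abc: "k = 2 ^ a * 3 ^ b * 5 ^ c" using less.IH by blast
    from less.prems(2)[OF q] consider "q = 2" | "q = 3" | "q = 5" by blast
    then show ?thesis
    proof cases
      case 1
      then have "n = 2 ^ Suc a * 3 ^ b * 5 ^ c" using k abc by simp
      then show ?thesis by blast
    next
      case 2
      then have "n = 2 ^ a * 3 ^ Suc b * 5 ^ c" using k abc by simp
      then show ?thesis by blast
    next
      case 3
      then have "n = 2 ^ a * 3 ^ b * 5 ^ Suc c" using k abc by simp
      then show ?thesis by blast
    qed
  qed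
qed

lemma exponent_le_of_not_dvd:
  fixes p n :: nat
  assumes "\<not> p ^ Suc e dvd n" "p ^ a dvd n"
  shows "a \<le> e"
  using assms le_imp_power_dvd[of "Suc e" a p] dvd_trans not_less_eq_eq by blast

lemma power_of_2_cases:
  fixes n :: nat
  assumes "n > 0" "\<And>q. prime q \<Longrightarrow> q dvd n \<Longrightarrow> q = 2"
  shows "\<exists>a. n = 2 ^ a"
proof -
  obtain a b c where n: "n = 2 ^ a * 3 ^ b * 5 ^ c" using eq_prime_powers_235[of n] assms by auto
  have "b = 0" using assms(2)[of 3] n by (cases b) auto
  moreover have "c = 0" using assms(2)[of 5] n by (cases c) auto
  ultimately show ?thesis using n by auto
qed

lemma prime_nat_cases:
  assumes "prime (q::nat)" "q \<le> 7"
  shows "q \<in> {2, 3, 5, 7}"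
proof -
  have "q \<noteq> 4" "q \<noteq> 6" "q \<noteq> 0" "q \<noteq> 1" using assms(1) by auto
  then show ?thesis using assms(2) by auto
qed

lemma five_power_mod_4: "(5::nat) ^ e mod 4 = 1"
  by (induction e) (simp_all add: mod_mult_right_eq[symmetric])

lemma three_power_mod_8: "(3::nat) ^ e mod 8 = 1 \<or> (3::nat) ^ e mod 8 = 3"
proof (induction e)
  case (Suc e)
  have "3 ^ Suc e mod 8 = 3 * (3 ^ e mod 8) mod (8::nat)" by (simp only: power_Suc mod_mult_right_eq)
  then show ?case using Suc by auto
qed simp

lemma five_power_mod_8: "(5::nat) ^ e mod 8 = (if even e then 1 else 5)"
proof (induction e)
  case (Suc e)
  have "5 ^ Suc e mod 8 = 5 * (5 ^ e mod 8) mod (8::nat)" by (simp only: power_Suc mod_mult_right_eq)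
  then show ?case using Suc by auto
qed simp

lemma five_power_mod_3: "(5::nat) ^ e mod 3 = (if even e then 1 else 2)"
proof (induction e)
  case (Suc e)
  have "5 ^ Suc e mod 3 = 5 * (5 ^ e mod 3) mod (3::nat)" by (simp only: power_Suc mod_mult_right_eq)
  then show ?case using Suc by auto
qed simp

text \<open>Otherwise \<open>m\<close> is a power of 2. Being larger than 2 it is a multiple of 4,
  and the prime 2 is excluding after all.\<close>

lemma excluding_prime_1_alpha_2:
  assumes "2 \<le> m" "m \<noteq> 2"
  shows "\<exists>p. excluding_prime m 2 1 p"
proof (rule ccontr)
  assume no: "\<not> ?thesis"
  have "q = 2" if q: "prime q" "q dvd m" for q
  proof -
    have "q \<le> 3" using excluding_prime_large[OF q(1), of 1 2 m m] q(2) assms no by force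
    moreover have "q \<noteq> 3" using excluding_prime_top[of 3 1 0 m 2] q no assms by auto
    ultimately show ?thesis using prime_nat_cases[OF q(1)] by auto
  qed
  then obtain a where a: "m = 2 ^ a" using power_of_2_cases[of m] assms by auto
  have "2 \<le> a" using assms a by (cases a; cases "a - 1") auto
  then have "2 ^ 2 dvd m" unfolding a by (rule le_imp_power_dvd)
  then show False using excluding_2_alpha_2[of m] assms no by auto
qed

text \<open>Otherwise \<open>m\<close> is a power of 2, while all prime factors of
  \<open>m + 3\<close> are at most 4 and differ from 2 and 3.\<close>

lemma excluding_prime_1_alpha_3:
  assumes "2 \<le> m"
  shows "\<exists>p. excluding_prime m 3 1 p"
proof (rule ccontr)
  assume no: "\<not> ?thesis"
  have le: "q \<le> 4" if q: "prime q" "q dvd m \<or> q dvd m + 3" for q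
    using excluding_prime_large[OF q(1), of 1 3 m m] q(2) assms no by force
  have n3: "\<not> 3 dvd m" using excluding_3_alpha_3[of m] assms no by auto
  have m2: "q = 2" if q: "prime q" "q dvd m" for q
    using le[OF q(1)] q n3 prime_nat_cases[OF q(1)] by auto
  then obtain a where a: "m = 2 ^ a" using power_of_2_cases[of m] assms by auto
  then have "even m" using assms by (cases a) auto
  obtain q where q: "prime q" "q dvd m + 3" using prime_factor_nat[of "m + 3"] by auto
  have "q \<noteq> 2" "q \<noteq> 3" using q(2) \<open>even m\<close> n3 by auto
  then show False using le[OF q(1)] q prime_nat_cases[OF q(1)] by auto
qed

text \<open>Otherwise \<open>m\<close> is a power of 2. The value 2 fails because 3 divides
  \<open>m + 4\<close>, so \<open>m\<close> is a multiple of 8 and the prime 2 is excluding.\<close>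

lemma excluding_prime_1_alpha_4:
  assumes "2 \<le> m" "m \<noteq> 4"
  shows "\<exists>p. excluding_prime m 4 1 p"
proof (rule ccontr)
  assume no: "\<not> ?thesis"
  have n3: "\<not> 3 dvd m" "\<not> 3 dvd m + 4" using excluding_3_alpha_4[of m] assms no by auto
  have "q = 2" if q: "prime q" "q dvd m" for q
  proof -
    have "q \<le> 5" using excluding_prime_large[OF q(1), of 1 4 m m] q(2) assms no by force
    moreover have "q \<noteq> 5" using excluding_prime_top[of 5 1 0 m 4] q no assms by auto
    ultimately show ?thesis using prime_nat_cases[OF q(1)] n3 q by auto
  qed
  then obtain a where a: "m = 2 ^ a" using power_of_2_cases[of m] assms by auto
  have "a \<notin> {0, 1, 2}"
  proof
    assume "a \<in> {0, 1, 2}"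
    then show False using assms a n3(2) by auto
  qed
  then have "3 \<le> a" by auto
  then have "2 ^ 3 dvd m" unfolding a by (rule le_imp_power_dvd)
  then show False using excluding_2_alpha_4[of m] assms no by auto
qed

lemma le_of_no_excluding_prime:
  assumes no: "\<not> (\<exists>p. excluding_prime m \<alpha> k p)" and k: "k \<le> m"
    and q: "prime q" "m - k < i" "i \<le> m" "q dvd i \<or> q dvd i + \<alpha>"
  shows "q \<le> k + \<alpha>"
  using excluding_prime_large[OF q(1) _ q(2-4)] no by (meson not_le)

text \<open>Otherwise \<open>m\<close> and \<open>m - 1\<close> have only the prime factors 2 and 3,
  with 3 at most once. The odd one of the two is then at most 3, so \<open>m = 4\<close>, which has
  an excluded residue modulo 9.\<close>

lemma excluding_prime_2_alpha_3:
  assumes "4 \<le> m"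
  shows "\<exists>p. excluding_prime m 3 2 p"
proof (rule ccontr)
  assume no: "\<not> ?thesis"
  have le: "q \<le> 5" if "prime q" "m - 2 < i" "i \<le> m" "q dvd i \<or> q dvd i + 3" for q i
    using le_of_no_excluding_prime[OF no _ that] assms by simp
  have smooth: "\<exists>a b c. i = 2 ^ a * 3 ^ b * 5 ^ c" if i: "m - 2 < i" "i \<le> m" for i
  proof (rule eq_prime_powers_235)
    fix q assume "prime q" "q dvd i"
    then show "q \<in> {2, 3, 5}" using le[of q i] i prime_nat_cases[of q] by auto
  qed (use i in simp)
  have n5: "\<not> 5 dvd m" "\<not> 5 dvd m - 1"
    using excluding_prime_top[of 5 2 0 m 3] excluding_prime_top[of 5 2 1 m 3] no assms by auto
  have m9: "m mod 9 \<notin> {0, 1, 3, 4}"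
  proof
    assume "m mod 9 \<in> {0, 1, 3, 4}"
    then have "excluding_prime m 3 2 3" by (rule excluding_3_alpha_3_2) (use assms in simp)
    then show False using no by blast
  qed
  obtain a b c where m: "m = 2 ^ a * 3 ^ b * 5 ^ c"
    using smooth[of m] assms by auto
  obtain a' b' c' where m1: "m - 1 = 2 ^ a' * 3 ^ b' * 5 ^ c'"
    using smooth[of "m - 1"] diff_less_mono2[of 1 2 m] assms by auto
  have c: "c = 0" using n5(1) unfolding m by (cases c) auto
  have c': "c' = 0" using n5(2) unfolding m1 by (cases c') auto
  have "\<not> 3 ^ 2 dvd m" using m9 by (auto simp: dvd_eq_mod_eq_0)
  then have b: "b \<le> 1" using exponent_le_of_not_dvd[of 3 1 m b] unfolding m by simp
  have "\<not> 3 ^ 2 dvd m - 1" using m9 assms by simp presburger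
  then have b': "b' \<le> 1" using exponent_le_of_not_dvd[of 3 1 "m - 1" b'] unfolding m1 by simp
  have "b = 0 \<or> b = 1" "b' = 0 \<or> b' = 1" using b b' by auto
  moreover have "a = 0 \<or> a' = 0"
  proof (rule ccontr)
    assume "\<not> ?thesis"
    then have "even m" "even (m - 1)" using m m1 by auto
    then show False using assms by presburger
  qed
  ultimately have "m \<le> 3 \<or> m - 1 \<le> 3" using m m1 c c' by auto
  then show False using m9 assms by (cases "m = 4") auto
qed

text \<open>Otherwise \<open>m\<close> is a power of 2 and \<open>m - 1\<close> a power of 5, each
  possibly times 3. If 3 does not divide \<open>m - 1\<close>, then 4 does not divide
  \<open>m\<close>, so \<open>m\<close> is 2 or 6. If it does, then 15 divides \<open>m - 1\<close>,
  and \<open>m + 3\<close> has no admissible prime factor.\<close>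

lemma excluding_prime_2_alpha_4:
  assumes "4 \<le> m" "m \<noteq> 4" "m \<noteq> 6"
  shows "\<exists>p. excluding_prime m 4 2 p"
proof (rule ccontr)
  assume no: "\<not> ?thesis"
  define n where "n = m - 2"
  then have n: "m = n + 2" "m - 1 = n + 1" "m - 2 = n" using assms(1) by simp_all
  have le: "q \<le> 6" if "prime q" "m - 2 < i" "i \<le> m" "q dvd i \<or> q dvd i + 4" for q i
    using le_of_no_excluding_prime[OF no _ that] assms by simp
  have smooth: "\<exists>a b c. i = 2 ^ a * 3 ^ b * 5 ^ c" if i: "m - 2 < i" "i \<le> m" for i
  proof (rule eq_prime_powers_235)
    fix q assume "prime q" "q dvd i"
    then show "q \<in> {2, 3, 5}" using le[of q i] i prime_nat_cases[of q] by auto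
  qed (use i in simp)
  have n5: "\<not> 5 dvd m" using excluding_prime_top[of 5 2 0 m 4] no assms by auto
  have m9: "m mod 9 \<notin> {0, 1, 3, 4}"
  proof
    assume "m mod 9 \<in> {0, 1, 3, 4}"
    then have "excluding_prime m 4 2 3" by (rule excluding_3_alpha_4_2) (use assms in simp)
    then show False using no by blast
  qed
  obtain a b c where m: "m = 2 ^ a * 3 ^ b * 5 ^ c"
    using smooth[of m] assms by auto
  obtain a' d e where m1: "m - 1 = 2 ^ a' * 3 ^ d * 5 ^ e"
    using smooth[of "m - 1"] diff_less_mono2[of 1 2 m] assms by auto
  have c: "c = 0" using n5(1) unfolding m by (cases c) auto
  have "\<not> 3 ^ 2 dvd m" using m9 by (auto simp: dvd_eq_mod_eq_0)
  then have "b \<le> 1" using exponent_le_of_not_dvd[of 3 1 m b] unfolding m by simp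
  then have b: "b = 0 \<or> b = 1" by auto
  have "\<not> 3 ^ 2 dvd m - 1" using m9 unfolding n(2,3) unfolding n(1) by simp presburger
  then have "d \<le> 1" using exponent_le_of_not_dvd[of 3 1 "m - 1" d] unfolding m1 by simp
  then have d: "d = 0 \<or> d = 1" by auto
  have a: "a \<noteq> 0" using m c b assms by (cases a) auto
  then have ev: "even m" using m by auto
  then have "odd (m - 1)" unfolding n(2,3) unfolding n(1) by presburger
  then have a': "a' = 0" unfolding m1 by (cases a') auto
  from d show False
  proof
    assume "d = 0"
    then have "(m - 1) mod 4 = 1" using m1 a' five_power_mod_4 by simp
    then have "m mod 4 = 2" unfolding n(2,3) unfolding n(1) by presburger
    then have "\<not> 2 ^ 2 dvd m" by (auto simp: dvd_eq_mod_eq_0)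
    then have "a \<le> 1" using exponent_le_of_not_dvd[of 2 1 m a] unfolding m by simp
    then have "a = 1" using a by simp
    then show False using m b c assms by auto
  next
    assume d: "d = 1"
    have m3: "3 dvd m - 1" unfolding m1 d by simp
    have "e \<noteq> 0" using m1 d a' assms by (cases e) auto
    then have "5 dvd m - 1" unfolding m1 by auto
    obtain q where q: "prime q" "q dvd m - 1 + 4" using prime_factor_nat[of "m - 1 + 4"] by auto
    then have "q \<le> 6" using le[OF q(1), of "m - 1"] diff_less_mono2[of 1 2 m] assms by simp
    then have "q \<in> {2, 3, 5}" using prime_nat_cases[OF q(1)] by auto
    moreover have "q \<noteq> 2" using q(2) ev assms by auto
    moreover have "q \<noteq> 3" using q(2) m3 dvd_add_right_iff[of 3 "m - 1" 4] by auto
    ultimately have "5 dvd m - 1 + 4" using q(2) by auto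
    then have "5 dvd (4::nat)" using \<open>5 dvd m - 1\<close> dvd_add_right_iff by blast
    then show False by simp
  qed
qed

text \<open>Otherwise \<open>m\<close>, \<open>m - 1\<close> and \<open>m - 2\<close> have no prime
  factors besides 2, 3, 5, and 5 does not divide \<open>m\<close>. Residues of powers of 3 and 5
  modulo 3, 4 and 8 rule out three such consecutive integers beyond 6.\<close>

lemma excluding_prime_3_alpha_4:
  assumes "6 \<le> m" "m \<noteq> 6"
  shows "\<exists>p. excluding_prime m 4 3 p"
proof (rule ccontr)
  assume no: "\<not> ?thesis"
  define n where "n = m - 2"
  then have n: "m = n + 2" "m - 1 = n + 1" "m - 2 = n" using assms(1) by simp_all
  have le: "q \<le> 7" if "prime q" "m - 3 < i" "i \<le> m" "q dvd i \<or> q dvd i + 4" for q i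
    using le_of_no_excluding_prime[OF no _ that] assms by simp
  have n5: "\<not> 5 dvd m" using excluding_prime_top[of 5 3 0 m 4] no assms by auto
  have n7: "\<not> 7 dvd m - i" if "i < 3" for i
  proof
    assume "7 dvd m - i"
    then have "excluding_prime m 4 3 7" by (intro excluding_prime_top[of 7 3 i]) (use that assms in auto)
    then show False using no by blast
  qed
  have smooth: "\<exists>a b c. i = 2 ^ a * 3 ^ b * 5 ^ c" if i: "i \<in> {m, m - 1, m - 2}" for i
  proof (rule eq_prime_powers_235)
    fix q assume q: "prime q" "q dvd i"
    then have "q \<noteq> 7" using i n7[of 0] n7[of 1] n7[of 2] by auto
    then show "q \<in> {2, 3, 5}" using le[of q i] i q prime_nat_cases[of q] assms by auto
  qed (use i assms in auto)
  obtain a b c where m: "m = 2 ^ a * 3 ^ b * 5 ^ c"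
    using smooth[of m] by auto
  obtain a1 b1 c1 where m1: "m - 1 = 2 ^ a1 * 3 ^ b1 * 5 ^ c1"
    using smooth[of "m - 1"] by auto
  obtain a2 b2 c2 where m2: "m - 2 = 2 ^ a2 * 3 ^ b2 * 5 ^ c2"
    using smooth[of "m - 2"] by auto
  have c: "c = 0" using n5(1) unfolding m by (cases c) auto
  have two: "x = 0" if "n = 2 ^ x * 3 ^ y * 5 ^ z" "odd n" for n x y z :: nat
    using that by (cases x) auto
  have three: "y = 0" if "n = 2 ^ x * 3 ^ y * 5 ^ z" "\<not> 3 dvd n" for n x y z :: nat
    using that by (cases y) auto
  have five: "z = 0" if "n = 2 ^ x * 3 ^ y * 5 ^ z" "\<not> 5 dvd n" for n x y z :: nat
    using that by (cases z) auto
  have five': "5 dvd n" if "n = 2 ^ x * 3 ^ y * 5 ^ z" "z \<noteq> 0" for n x y z :: nat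
    using that by auto
  have four: "x = 1" if "n = 2 ^ x * 3 ^ y * 5 ^ z" "n mod 4 = 2" for n x y z :: nat
  proof -
    have "\<not> 2 ^ 2 dvd n" using that(2) by (auto simp: dvd_eq_mod_eq_0)
    then have "x \<le> 1" using exponent_le_of_not_dvd[of 2 1 n x] unfolding that(1) by simp
    moreover have "even n" using that(2) by presburger
    then have "x \<noteq> 0" using that(1) by (cases x) auto
    ultimately show ?thesis by simp
  qed
  show False
  proof (cases "even m")
    case False
    \<comment> \<open>Here \<open>m\<close> is a power of 3, so \<open>m - 2\<close> is a power of 5
      and \<open>m - 1\<close> a power of 2 that is 2 modulo 4.\<close>
    then have "a = 0" by (rule two[OF m])
    then have "b \<noteq> 0" using m c assms by (cases b) auto
    then have "3 dvd m" using m by auto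
    then have "\<not> 3 dvd m - 1" "\<not> 3 dvd m - 2" unfolding n(2,3) unfolding n(1) by presburger+
    then have b12: "b1 = 0" "b2 = 0" using three[OF m1] three[OF m2] by auto
    have "odd (m - 2)" using False unfolding n(2,3) unfolding n(1) by presburger
    then have a2: "a2 = 0" by (rule two[OF m2])
    then have "c2 \<noteq> 0" using m2 b12 assms by (cases c2) auto
    then have "5 dvd m - 2" by (rule five'[OF m2])
    then have "\<not> 5 dvd m - 1" unfolding n(2,3) unfolding n(1) by presburger
    then have "c1 = 0" by (rule five[OF m1])
    have "(m - 2) mod 4 = 1" using m2 a2 b12 five_power_mod_4 by simp
    then have "(m - 1) mod 4 = 2" unfolding n(2,3) unfolding n(1) by presburger
    then have "a1 = 1" by (rule four[OF m1])
    then show False using m1 b12 \<open>c1 = 0\<close> assms by simp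
  next
    case True
    then have "odd (m - 1)" unfolding n(2,3) unfolding n(1) by presburger
    then have a1: "a1 = 0" by (rule two[OF m1])
    show False
    proof (cases "b = 0")
      case False
      \<comment> \<open>Here \<open>m - 1\<close> is a power of 5 and \<open>m - 2\<close> a power
        of 2 not divisible by 8.\<close>
      then have "3 dvd m" using m by auto
      then have n3: "\<not> 3 dvd m - 1" "\<not> 3 dvd m - 2" and m3: "(m - 1) mod 3 = 2" unfolding n(2,3) unfolding n(1) by presburger+
      then have b12: "b1 = 0" "b2 = 0" using three[OF m1] three[OF m2] by auto
      then have "c1 \<noteq> 0" using m1 a1 assms by (cases c1) auto
      then have "5 dvd m - 1" by (rule five'[OF m1])
      then have "\<not> 5 dvd m - 2" unfolding n(2,3) unfolding n(1) by presburger
      then have c2: "c2 = 0" by (rule five[OF m2])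
      show False
      proof (cases "4 dvd m")
        case True
        then have "(m - 2) mod 4 = 2" unfolding n(2,3) unfolding n(1) by presburger
        then have "a2 = 1" by (rule four[OF m2])
        then show False using m2 b12 c2 assms by simp
      next
        case False
        have "(5 ^ c1) mod 3 = (2::nat)" using m3 m1 a1 b12 by simp
        then have "odd c1" using five_power_mod_3[of c1] by (auto split: if_splits)
        then have "(m - 1) mod 8 = 5" using m1 a1 b12 five_power_mod_8[of c1] by simp
        then have "(m - 2) mod 8 = 4" unfolding n(2,3) unfolding n(1) by presburger
        then have "\<not> 2 ^ 3 dvd m - 2" by (auto simp: dvd_eq_mod_eq_0)
        then have "a2 \<le> 2" using exponent_le_of_not_dvd[of 2 2 "m - 2" a2] unfolding m2 by simp
        then have "m - 2 \<le> 2 ^ 2" unfolding m2 b12 c2 using power_increasing[of a2 2 "2::nat"] by simp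
        then show False using assms by simp
      qed
    next
      case b: True
      \<comment> \<open>Here \<open>m\<close> is a power of 2 divisible by 8. Then
        \<open>m - 1\<close> is 7 modulo 8, so it can be neither a power of 3 nor a power of
        5.\<close>
      have "3 \<le> a"
      proof (rule ccontr)
        assume "\<not> 3 \<le> a"
        then have "m \<le> 2 ^ 2" unfolding m b c using power_increasing[of a 2 "2::nat"] by simp
        then show False using assms by simp
      qed
      then have "2 ^ 3 dvd m" unfolding m b c by (simp add: le_imp_power_dvd del: power_numeral)
      then have m8: "m mod 8 = 0" by (simp add: dvd_eq_mod_eq_0)
      then have "(m - 2) mod 4 = 2" unfolding n(2,3) unfolding n(1) by presburger
      then have a2: "a2 = 1" by (rule four[OF m2])
      show False
      proof (cases "3 dvd m - 1")
        case True
        then have "\<not> 3 dvd m - 2" unfolding n(2,3) unfolding n(1) by presburger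
        then have "b2 = 0" by (rule three[OF m2])
        then have "c2 \<noteq> 0" using m2 a2 assms by (cases c2) auto
        then have "5 dvd m - 2" by (rule five'[OF m2])
        then have "\<not> 5 dvd m - 1" unfolding n(2,3) unfolding n(1) by presburger
        then have "c1 = 0" by (rule five[OF m1])
        then have "(m - 1) mod 8 = 1 \<or> (m - 1) mod 8 = 3" using m1 a1 three_power_mod_8[of b1] by simp
        then show False using m8 unfolding n(2,3) unfolding n(1) by presburger
      next
        case False
        then have "b1 = 0" by (rule three[OF m1])
        then have "(m - 1) mod 4 = 1" using m1 a1 five_power_mod_4[of c1] by simp
        then show False using m8 unfolding n(2,3) unfolding n(1) by presburger
      qed
    qed
  qed
qed

theorem excluding_prime_exists:
  assumes "\<alpha> \<in> {0, 1, 2, 3, 4}" "1 \<le> k" "2 * k \<le> m" "(m, \<alpha>) \<notin> {(2, 2), (4, 4), (6, 4)}"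
  shows "\<exists>p. excluding_prime m \<alpha> k p"
proof (cases "\<alpha> \<le> k")
  case True
  then show ?thesis using assms by (intro excluding_prime_exists_of_ge) auto
next
  case False
  then consider "k = 1" "\<alpha> = 2" | "k = 1" "\<alpha> = 3" | "k = 1" "\<alpha> = 4" | "k = 2" "\<alpha> = 3"
    | "k = 2" "\<alpha> = 4" | "k = 3" "\<alpha> = 4" using assms(1,2) by force
  then show ?thesis
    using assms excluding_prime_1_alpha_2 excluding_prime_1_alpha_3 excluding_prime_1_alpha_4
      excluding_prime_2_alpha_3 excluding_prime_2_alpha_4 excluding_prime_3_alpha_4
    by cases auto
qed

section \<open>Expansions in powers of a monic polynomial\<close>

lemma poly_mod_eq_iff_dvd: "poly_mod.Mp m f = poly_mod.Mp m g \<longleftrightarrow> [:m:] dvd f - g"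
  by (auto simp: poly_eq_iff poly_mod.Mp_coeff poly_mod.M_def const_poly_dvd_iff mod_eq_dvd_iff)

lemma degree_diff_less_of_lead_coeff_eq:
  fixes f g :: "'a::ab_group_add poly"
  assumes "degree f > 0" "degree g \<le> degree f" "coeff g (degree f) = lead_coeff f"
  shows "degree (f - g) < degree f"
proof (intro degree_lessI allI impI)
  fix k assume "degree f \<le> k"
  then show "coeff (f - g) k = 0" using assms by (cases "k = degree f") (simp_all add: coeff_eq_0)
qed (use assms in simp)

lemma division_by_monic:
  fixes f \<phi> :: "'a::idom poly"
  assumes "monic \<phi>" "degree \<phi> > 0"
  shows "\<exists>q r. f = q * \<phi> + r \<and> degree r < degree \<phi>"
proof (induction "degree f" arbitrary: f rule: less_induct)
  case less
  show ?case
  proof (cases "degree f < degree \<phi>")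
    case True
    then show ?thesis by (intro exI[of _ 0] exI[of _ f]) auto
  next
    case False
    define h where "h = monom (lead_coeff f) (degree f - degree \<phi>)"
    have f0: "f \<noteq> 0" "degree f > 0" using False assms(2) by auto
    have "degree (h * \<phi>) \<le> degree f"
      using False degree_mult_le[of h \<phi>] degree_monom_le[of "lead_coeff f" "degree f - degree \<phi>"]
      unfolding h_def by linarith
    moreover have "coeff (h * \<phi>) (degree f) = coeff f (degree f)"
      using False assms(1) by (simp add: h_def coeff_monom_mult)
    ultimately have "degree (f - h * \<phi>) < degree f"
      by (intro degree_diff_less_of_lead_coeff_eq f0)
    from less[OF this] obtain q r where "f - h * \<phi> = q * \<phi> + r" "degree r < degree \<phi>" by blast
    then show ?thesis by (intro exI[of _ "q + h"] exI[of _ r]) (auto simp: algebra_simps)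
  qed
qed

text \<open>Uniqueness of quotient and remainder modulo \<open>c\<close>: since
  \<open>\<phi>\<close> is monic, the coefficients of \<open>q\<close> can be cleared from the top
  down by looking at degree \<open>n + degree \<phi>\<close>.\<close>

lemma monic_mult_dvd_degree:
  fixes c :: int
  assumes "monic \<phi>" "[:c:] dvd q * \<phi> + r" "degree r < degree \<phi>"
  shows "[:c:] dvd q" "[:c:] dvd r"
proof -
  have q: "c dvd coeff q n" for n
  proof (induction "degree q - n" arbitrary: n rule: less_induct)
    case less
    show ?case
    proof (cases "n > degree q")
      case True
      then show ?thesis by (simp add: coeff_eq_0)
    next
      case False
      have "c dvd coeff (q * \<phi> + r) (n + degree \<phi>)" using assms(2) by (auto simp: const_poly_dvd_iff)
      also have "coeff (q * \<phi> + r) (n + degree \<phi>) = coeff (q * \<phi>) (n + degree \<phi>)"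
        using assms(3) by (simp add: coeff_eq_0)
      also have "\<dots> = (\<Sum>i\<le>n + degree \<phi>. coeff q i * coeff \<phi> (n + degree \<phi> - i))"
        by (rule coeff_mult)
      also have "\<dots> = coeff q n * coeff \<phi> (n + degree \<phi> - n) +
          (\<Sum>i\<in>{..n + degree \<phi>} - {n}. coeff q i * coeff \<phi> (n + degree \<phi> - i))"
        by (rule sum.remove) auto
      finally have "c dvd coeff q n +
          (\<Sum>i\<in>{..n + degree \<phi>} - {n}. coeff q i * coeff \<phi> (n + degree \<phi> - i))"
        using assms(1) by simp
      moreover have "c dvd (\<Sum>i\<in>{..n + degree \<phi>} - {n}. coeff q i * coeff \<phi> (n + degree \<phi> - i))"
      proof (rule dvd_sum)
        fix i assume i: "i \<in> {..n + degree \<phi>} - {n}"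
        show "c dvd coeff q i * coeff \<phi> (n + degree \<phi> - i)"
        proof (cases "i < n")
          case True
          then show ?thesis by (simp add: coeff_eq_0)
        next
          case False
          then have "c dvd coeff q i"
            using less[of i] i \<open>\<not> n > degree q\<close>
            by (cases "i > degree q") (auto simp: coeff_eq_0)
          then show ?thesis by simp
        qed
      qed
      ultimately show ?thesis using dvd_add_left_iff by blast
    qed
  qed
  then show *: "[:c:] dvd q" by (auto simp: const_poly_dvd_iff)
  have "[:c:] dvd (q * \<phi> + r) - q * \<phi>" by (rule dvd_diff[OF assms(2) dvd_mult2[OF *]])
  then show "[:c:] dvd r" by simp
qed

lemma prime_elem_const_int_poly: "prime p \<Longrightarrow> prime_elem [:int p:]"
  using prime_elem_const_poly_iff[of "int p"] prime_imp_prime_elem[of "int p"] by simp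

text \<open>The smallest degree of a counterexample \<open>u\<close> would, by dividing \<open>\<phi>\<close> by \<open>u\<close>, produce a
  factor of \<open>\<phi>\<close> modulo \<open>p\<close>.\<close>
lemma irreducible_m_prime:
  fixes \<phi> u v :: "int poly"
  assumes p: "prime p" and mon: "monic \<phi>" and irr: "poly_mod.irreducible_m (int p) \<phi>"
  shows "degree u < degree \<phi> \<Longrightarrow> \<not> [:int p:] dvd u \<Longrightarrow> degree v < degree \<phi>
    \<Longrightarrow> \<not> [:int p:] dvd v \<Longrightarrow> \<not> [:int p:] dvd u * v - q * \<phi>"
proof (induction "degree u" arbitrary: u q rule: less_induct)
  case less
  interpret poly_mod "int p" .
  note irr' = irr[unfolded irreducible_m_def dvdm_def poly_mod_eq_iff_dvd]
  let ?P = "[:int p:]"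
  have pr: "prime_elem ?P" using p by (rule prime_elem_const_int_poly)
  show ?case
  proof
    assume uv: "?P dvd u * v - q * \<phi>"
    have u0: "u \<noteq> 0" using less.prems(2) by auto
    show False
    proof (cases "int p dvd lead_coeff u")
      case True
      \<comment> \<open>A leading term divisible by \<open>p\<close> may be dropped, which lowers
        the degree.\<close>
      define u' where "u' = u - monom (lead_coeff u) (degree u)"
      have m: "?P dvd monom (lead_coeff u) (degree u)" using True by (auto simp: const_poly_dvd_iff)
      have deg: "degree u \<noteq> 0"
      proof
        assume "degree u = 0"
        then obtain c where "u = [:c:]" by (rule degree_eq_zeroE)
        with m less.prems(2) show False by (simp add: monom_0)
      qed
      have d: "degree u' < degree u"
        unfolding u'_def using deg by (intro degree_diff_less_of_lead_coeff_eq) (auto simp: degree_monom_le)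
      have "\<not> ?P dvd u'" using dvd_add[of ?P u' "monom (lead_coeff u) (degree u)"] m less.prems(2)
        by (auto simp: u'_def)
      moreover have "?P dvd u' * v - q * \<phi>"
      proof -
        have "u' * v - q * \<phi> = (u * v - q * \<phi>) - monom (lead_coeff u) (degree u) * v"
          by (simp add: u'_def algebra_simps)
        then show ?thesis using dvd_diff[OF uv dvd_mult2[OF m, of v]] by (simp only:)
      qed
      ultimately show False using less.hyps[OF d, of q] less.prems d by auto
    next
      case False
      show False
      proof (cases "degree u = 0")
        case True
        then obtain c where c: "u = [:c:]" by (rule degree_eq_zeroE)
        then have "\<not> int p dvd c" using False by simp
        have "?P dvd (- q) * \<phi> + [:c:] * v" using uv c by (simp add: algebra_simps)
        moreover have "degree ([:c:] * v) < degree \<phi>" using less.prems(3)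
          using degree_smult_le[of c v] by simp
        ultimately have "?P dvd [:c:] * v" using monic_mult_dvd_degree(2)[OF mon] by blast
        with prime_elem_dvd_multD[OF pr this] less.prems(2,4) c show False by blast
      next
        case deg: False
        obtain s where "[lead_coeff u * s = 1] (mod int p)"
          using cong_solve_coprime_int[of "lead_coeff u" "int p"]
            prime_imp_coprime[of "int p" "lead_coeff u"] False p by (auto simp: ac_simps)
        then have s: "int p dvd 1 - lead_coeff u * s"
          by (simp add: cong_iff_dvd_diff dvd_diff_commute)
        \<comment> \<open>Modulo \<open>p\<close> this is \<open>u\<close> divided by its leading
          coefficient; the added monomial makes it monic over the integers.\<close>
        define w where "w = smult s u + monom (1 - lead_coeff u * s) (degree u)"
        have w_le: "degree w \<le> degree u" unfolding w_def
          by (intro degree_add_le) (auto simp: degree_monom_le)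
        have w_c: "coeff w (degree u) = 1" by (simp add: w_def)
        then have w_d: "degree w = degree u" using w_le by (metis le_antisym le_degree zero_neq_one)
        have w_m: "monic w" using w_c w_d by simp
        have pw: "?P dvd monom (1 - lead_coeff u * s) (degree u)"
          using s by (auto simp: const_poly_dvd_iff)
        obtain t r where tr: "\<phi> = t * w + r" "degree r < degree w"
          using division_by_monic[OF w_m, of \<phi>] w_d deg by auto
        have pwv: "?P dvd w * v - smult s q * \<phi>"
        proof -
          have "w * v - smult s q * \<phi> = smult s (u * v - q * \<phi>) + monom (1 - lead_coeff u * s) (degree u) * v"
            by (simp add: w_def algebra_simps smult_diff_right)
          then show ?thesis using dvd_add[OF dvd_smult[OF uv, of s] dvd_mult2[OF pw, of v]] by simp
        qed
        \<comment> \<open>The remainder \<open>r\<close> inherits the relation with \<open>v\<close>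
          and has smaller degree, so it vanishes modulo \<open>p\<close> and \<open>w\<close>
          divides \<open>\<phi>\<close> there.\<close>
        have "?P dvd r * v - (v - t * smult s q) * \<phi>"
        proof -
          have "r * v - (v - t * smult s q) * \<phi> = - t * (w * v - smult s q * \<phi>)"
            by (subst (1 2) tr(1)) (simp add: algebra_simps tr(1) smult_add_right)
          then show ?thesis using dvd_mult[OF pwv, of "- t"] by simp
        qed
        then have pr_r: "?P dvd r"
          using less.hyps[of r "v - t * smult s q"] tr(2) w_d less.prems by auto
        then have "?P dvd \<phi> - t * w" using tr(1) by simp
        then consider a where "?P dvd 1 - t * a" | a where "?P dvd 1 - w * a" using irr' by blast
        then show False
        proof cases
          case 1
          \<comment> \<open>With \<open>t\<close> invertible, \<open>w\<close> is a multiple of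
            \<open>\<phi>\<close> modulo \<open>p\<close>, although its degree is smaller. In the
            other case the same happens to \<open>v\<close>.\<close>
          have "?P dvd a * \<phi> + (- w)"
          proof -
            have "a * \<phi> + (- w) = - (1 - t * a) * w + a * r"
              by (subst tr(1)) (simp add: algebra_simps)
            moreover have "?P dvd - (1 - t * a)" using 1 by (simp only: dvd_minus_iff)
            ultimately show ?thesis using dvd_add[OF dvd_mult2[of ?P "- (1 - t * a)" w] dvd_mult[OF pr_r, of a]] by simp
          qed
          then have "?P dvd - w" by (rule monic_mult_dvd_degree(2)[OF mon]) (use w_d less.prems(1) in simp)
          then have "?P dvd w" by simp
          then have "int p dvd coeff w (degree u)" by (simp only: const_poly_dvd_iff)
          then show False using w_c p by simp
        next
          case 2
          have "?P dvd (smult s q * a) * \<phi> + - v + (v - v)"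
          proof -
            have "?P dvd (1 - w * a) * v + a * (w * v - smult s q * \<phi>)" using 2 pwv by (intro dvd_add dvd_mult dvd_mult2)
            then have "?P dvd - ((1 - w * a) * v + a * (w * v - smult s q * \<phi>))"
              by (simp only: dvd_minus_iff)
            then show ?thesis by (simp add: algebra_simps)
          qed
          then have "?P dvd (smult s q * a) * \<phi> + (- v)" by simp
          then have "?P dvd - v" by (rule monic_mult_dvd_degree(2)[OF mon]) (use less.prems(3) in simp)
          with less.prems(4) show False by simp
        qed
      qed
    qed
  qed
qed

section \<open>Gauss's lemma\<close>

lemma rat_poly_common_denominator:
  fixes f :: "rat poly"
  shows "\<exists>c g. c \<noteq> 0 \<and> smult (rat_of_int c) f = map_poly rat_of_int g"
proof (induction f)
  case 0
  show ?case by (intro exI[of _ 1] exI[of _ 0]) auto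
next
  case (pCons a f)
  then obtain c g where cg: "c \<noteq> 0" "smult (rat_of_int c) f = map_poly rat_of_int g" by blast
  obtain u v where uv: "a = rat_of_int u / rat_of_int v" "v > 0" by (cases a) (auto simp: Fract_of_int_quotient)
  have "smult (rat_of_int (c * v)) (pCons a f) = map_poly rat_of_int (pCons (c * u) (smult v g))"
    using uv cg(2)[symmetric] by (simp add: hom_distribs mult.commute)
  then show ?case using cg(1) uv(2) by (intro exI[of _ "c * v"] exI[of _ "pCons (c * u) (smult v g)"]) auto
qed

text \<open>Clear denominators and compare primitive parts, which are multiplicative. The content of
  \<open>f\<close> and the sign go into the first factor.\<close>

lemma rat_factors_imp_int_factors:
  fixes f :: "int poly" and g h :: "rat poly"
  assumes "map_poly rat_of_int f = g * h"
  shows "\<exists>g' h'. f = g' * h' \<and> degree g' = degree g \<and> degree h' = degree h"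
proof (cases "f = 0")
  case True
  then consider "g = 0" | "h = 0" using assms by auto
  then show ?thesis
  proof cases
    case 1
    then show ?thesis using True by (intro exI[of _ 0] exI[of _ "monom 1 (degree h)"]) (auto simp: degree_monom_eq)
  next
    case 2
    then show ?thesis using True by (intro exI[of _ "monom 1 (degree g)"] exI[of _ 0]) (auto simp: degree_monom_eq)
  qed
next
  case False
  obtain c d g1 h1 where c: "c \<noteq> 0" "smult (rat_of_int c) g = map_poly rat_of_int g1"
    and d: "d \<noteq> 0" "smult (rat_of_int d) h = map_poly rat_of_int h1"
    using rat_poly_common_denominator by metis
  have "map_poly rat_of_int (smult (c * d) f) = map_poly rat_of_int (g1 * h1)"
    using c(2) d(2) assms by (simp add: hom_distribs mult.commute flip: c(2) d(2))
  then have eq: "smult (c * d) f = g1 * h1" by simp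
  have "smult (unit_factor (c * d)) (primitive_part f) = primitive_part g1 * primitive_part h1"
    using arg_cong[OF eq, of primitive_part] by (simp add: primitive_part_smult primitive_part_mult)
  then have "smult (unit_factor (c * d) * unit_factor (c * d)) (primitive_part f) =
      smult (unit_factor (c * d)) (primitive_part g1 * primitive_part h1)"
    by (simp only: flip: smult_smult)
  moreover have "unit_factor (c * d) * unit_factor (c * d) = 1"
    using c(1) d(1) by (simp add: sgn_if)
  ultimately have "primitive_part f = smult (unit_factor (c * d)) (primitive_part g1 * primitive_part h1)"
    by simp
  then have "smult (content f) (primitive_part f) =
      smult (content f * unit_factor (c * d)) (primitive_part g1) * primitive_part h1"
    by simp
  then have "f = smult (content f * unit_factor (c * d)) (primitive_part g1) * primitive_part h1"
    by (simp only: content_times_primitive_part)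
  moreover have "degree (primitive_part h1) = degree h"
    using arg_cong[OF d(2), of degree] d(1) by simp
  moreover have "degree (smult (content f * unit_factor (c * d)) (primitive_part g1)) = degree g"
    using arg_cong[OF c(2), of degree] c(1) d(1) False by (simp add: sgn_if)
  ultimately show ?thesis by blast
qed

section \<open>Expansions in powers of \<phi> and their products\<close>

text \<open>An expansion in powers of \<open>\<phi>\<close> is encoded as a polynomial in an outer
  variable, and \<open>poly G \<phi>\<close> evaluates it. The strict bound at zero coefficients
  forces \<open>degree \<phi> > 0\<close>.\<close>

definition phi_reduced :: "'a::zero poly \<Rightarrow> 'a poly poly \<Rightarrow> bool" where
  "phi_reduced \<phi> G \<longleftrightarrow> (\<forall>i. degree (coeff G i) < degree \<phi>)"

lemma phi_reduced_0: "phi_reduced \<phi> 0 \<longleftrightarrow> degree \<phi> > 0"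
  by (simp add: phi_reduced_def)

lemma phi_reduced_pCons: "phi_reduced \<phi> (pCons r G) \<longleftrightarrow> degree r < degree \<phi> \<and> phi_reduced \<phi> G"
  unfolding phi_reduced_def by (auto simp: coeff_pCons split: nat.splits)

lemma phi_expansion_exists:
  fixes f :: "'a::idom poly"
  assumes mon: "monic \<phi>" and deg: "degree \<phi> > 0"
  shows "\<exists>G. phi_reduced \<phi> G \<and> poly G \<phi> = f"
proof (induction "degree f" arbitrary: f rule: less_induct)
  case less
  obtain q r where qr: "f = q * \<phi> + r" "degree r < degree \<phi>"
    using division_by_monic[OF mon deg] by blast
  show ?case
  proof (cases "q = 0")
    case True
    then show ?thesis using qr deg by (intro exI[of _ "[:r:]"]) (auto simp: phi_reduced_pCons phi_reduced_0)
  next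
    case False
    have "\<phi> \<noteq> 0" using mon by auto
    then have "degree (q * \<phi>) = degree q + degree \<phi>" using False by (simp add: degree_mult_eq)
    then have "degree f = degree q + degree \<phi>" using qr by (simp add: degree_add_eq_left)
    then obtain G where "phi_reduced \<phi> G" "poly G \<phi> = q" using less[of q] deg by auto
    then show ?thesis using qr by (intro exI[of _ "pCons r G"]) (auto simp: phi_reduced_pCons)
  qed
qed

text \<open>No lower term reaches the degree of the top term, because all coefficients have degree
  below that of \<open>\<phi>\<close>.\<close>

lemma phi_expansion_degree:
  fixes \<phi> :: "'a::idom poly"
  assumes mon: "monic \<phi>"
  shows "phi_reduced \<phi> G \<Longrightarrow> G \<noteq> 0 \<Longrightarrow>
    degree (poly G \<phi>) = degree \<phi> * degree G + degree (lead_coeff G) \<and>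
    lead_coeff (poly G \<phi>) = lead_coeff (lead_coeff G)"
proof (induction G)
  case 0
  then show ?case by simp
next
  case (pCons r G)
  show ?case
  proof (cases "G = 0")
    case True
    then show ?thesis by simp
  next
    case False
    note IH = pCons.IH[OF _ False]
    have r: "degree r < degree \<phi>" and red: "phi_reduced \<phi> G" using pCons.prems by (auto simp: phi_reduced_pCons)
    have "lead_coeff (poly G \<phi>) \<noteq> 0" using IH[OF red] False by (metis leading_coeff_0_iff)
    then have nz: "poly G \<phi> \<noteq> 0" "\<phi> \<noteq> 0" using mon by auto
    then have d: "degree (\<phi> * poly G \<phi>) = degree \<phi> + degree (poly G \<phi>)" by (simp add: degree_mult_eq)
    then have "degree (r + \<phi> * poly G \<phi>) = degree \<phi> + degree (poly G \<phi>)"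
      using r by (simp add: degree_add_eq_right)
    moreover have "lead_coeff (r + \<phi> * poly G \<phi>) = lead_coeff (poly G \<phi>)"
      using r d mon lead_coeff_add_le[of r "\<phi> * poly G \<phi>"] lead_coeff_mult[of \<phi> "poly G \<phi>"] by simp
    ultimately show ?thesis 
      using conjunct1[OF IH[OF red]] conjunct2[OF IH[OF red]] False by (simp add: add.assoc)
  qed
qed

lemma phi_expansion_unique:
  fixes \<phi> :: "'a::idom poly"
  assumes mon: "monic \<phi>" and "phi_reduced \<phi> G" "phi_reduced \<phi> H" "poly G \<phi> = poly H \<phi>"
  shows "G = H"
proof (rule ccontr)
  assume "G \<noteq> H"
  then have nz: "G - H \<noteq> 0" by simp
  have "phi_reduced \<phi> (G - H)" using assms(2,3) by (auto simp: phi_reduced_def intro: degree_diff_less)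
  have "poly (G - H) \<phi> = 0" using assms(4) by simp
  then have "lead_coeff (lead_coeff (G - H)) = 0"
    using phi_expansion_degree[OF mon \<open>phi_reduced \<phi> (G - H)\<close> nz] by (metis coeff_0)
  then show False using nz by (metis leading_coeff_0_iff)
qed

lemma phi_carry_exists:
  fixes \<phi> :: "'a::idom poly"
  assumes mon: "monic \<phi>" and deg: "degree \<phi> > 0"
  shows "\<exists>Q R. P = smult \<phi> Q + R \<and> phi_reduced \<phi> R"
proof (induction P)
  case 0
  show ?case by (intro exI[of _ 0]) (simp add: deg phi_reduced_def)
next
  case (pCons a P)
  then obtain Q R where QR: "P = smult \<phi> Q + R" "phi_reduced \<phi> R" by blast
  obtain q r where "a = q * \<phi> + r" "degree r < degree \<phi>" using division_by_monic[OF mon deg] by blast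
  then show ?case using QR
    by (intro exI[of _ "pCons q Q"] exI[of _ "pCons r R"]) (auto simp: phi_reduced_pCons mult.commute)
qed

text \<open>Multiplication with carry. The coefficients of \<open>G * H\<close> have degree below
  \<open>2 * degree \<phi>\<close>, so the carries \<open>Q\<close> are already reduced and one
  shift completes the expansion.\<close>

lemma phi_expansion_mult:
  fixes \<phi> :: "'a::idom poly"
  assumes mon: "monic \<phi>" and deg: "degree \<phi> > 0"
    and red: "phi_reduced \<phi> G" "phi_reduced \<phi> H" "phi_reduced \<phi> F"
    and eq: "poly F \<phi> = poly G \<phi> * poly H \<phi>"
  obtains Q R where "G * H = smult \<phi> Q + R" "phi_reduced \<phi> R" "F = R + pCons 0 Q"
proof -
  obtain Q R where QR: "G * H = smult \<phi> Q + R" "phi_reduced \<phi> R"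
    using phi_carry_exists[OF mon deg] by blast
  have "degree (coeff Q i) < degree \<phi>" for i
  proof (cases "coeff Q i = 0")
    case True
    then show ?thesis using deg by simp
  next
    case False
    have "\<phi> \<noteq> 0" using mon by auto
    then have "degree (\<phi> * coeff Q i) = degree \<phi> + degree (coeff Q i)" using False by (simp add: degree_mult_eq)
    moreover have "degree (coeff R i) < degree \<phi>" using QR(2) by (simp add: phi_reduced_def)
    ultimately have "degree (coeff (G * H) i) = degree \<phi> + degree (coeff Q i)"
      unfolding QR(1) by (simp add: degree_add_eq_left)
    moreover have "degree (coeff (G * H) i) < degree \<phi> + degree \<phi>"
      unfolding coeff_mult using red(1,2) deg
      by (intro degree_sum_less) (auto simp: phi_reduced_def intro!: le_less_trans[OF degree_mult_le] add_strict_mono)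
    ultimately show ?thesis by simp
  qed
  then have "phi_reduced \<phi> (R + pCons 0 Q)"
    using QR(2) deg by (auto simp: phi_reduced_def coeff_pCons split: nat.splits intro: degree_add_less)
  moreover have "poly (R + pCons 0 Q) \<phi> = poly (G * H) \<phi>" unfolding QR(1) by (simp add: algebra_simps)
  ultimately have "F = R + pCons 0 Q"
    using phi_expansion_unique[OF mon red(3)] eq by simp
  with QR that show thesis by blast
qed

lemma phi_product_coeff_0_dvd:
  fixes \<phi> :: "int poly"
  assumes mon: "monic \<phi>" and deg: "degree \<phi> > 0"
    and red: "phi_reduced \<phi> G" "phi_reduced \<phi> H" "phi_reduced \<phi> F"
    and eq: "poly F \<phi> = poly G \<phi> * poly H \<phi>"
    and dvd: "[:c:] dvd coeff G 0 * coeff H 0"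
  shows "[:c:] dvd coeff F 0"
proof -
  obtain Q R where QR: "G * H = smult \<phi> Q + R" "phi_reduced \<phi> R" "F = R + pCons 0 Q"
    using phi_expansion_mult[OF mon deg red eq] .
  have "coeff Q 0 * \<phi> + coeff R 0 = coeff G 0 * coeff H 0"
    using arg_cong[OF QR(1), of "\<lambda>P. coeff P 0"] by (simp add: mult.commute coeff_mult)
  then have "[:c:] dvd coeff R 0"
    using monic_mult_dvd_degree(2)[OF mon, of c "coeff Q 0" "coeff R 0"] QR(2) dvd by (simp add: phi_reduced_def)
  then show ?thesis by (simp add: QR(3))
qed

text \<open>The analogue of adding Newton polygons. Up to higher powers of \<open>p\<close>, the
  coefficient at \<open>i0 + l0\<close> is the remainder of one product modulo
  \<open>\<phi>\<close>, since \<open>subdiag\<close> makes the incoming carry negligible. After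
  removal of \<open>p ^ (a + b)\<close>, divisibility would make \<open>u * v\<close> a multiple of
  \<open>\<phi>\<close> modulo \<open>p\<close>.\<close>

lemma phi_product_coeff_not_dvd:
  fixes \<phi> :: "int poly"
  assumes p: "prime p" and mon: "monic \<phi>" and deg: "degree \<phi> > 0"
    and irr: "poly_mod.irreducible_m (int p) \<phi>"
    and red: "phi_reduced \<phi> G" "phi_reduced \<phi> H" "phi_reduced \<phi> F"
    and eq: "poly F \<phi> = poly G \<phi> * poly H \<phi>"
    and G: "[:int p ^ a:] dvd coeff G i0" "\<not> [:int p ^ Suc a:] dvd coeff G i0"
    and H: "[:int p ^ b:] dvd coeff H l0" "\<not> [:int p ^ Suc b:] dvd coeff H l0"
    and diag: "\<And>i l. i + l = i0 + l0 \<Longrightarrow> (i, l) \<noteq> (i0, l0)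
      \<Longrightarrow> [:int p ^ Suc (a + b):] dvd coeff G i * coeff H l"
    and subdiag: "\<And>i l. Suc (i + l) = i0 + l0 \<Longrightarrow> [:int p ^ Suc (a + b):] dvd coeff G i * coeff H l"
  shows "\<not> [:int p ^ Suc (a + b):] dvd coeff F (i0 + l0)"
proof
  let ?J = "i0 + l0" and ?P = "[:int p ^ Suc (a + b):]"
  assume F: "?P dvd coeff F ?J"
  obtain Q R where QR: "G * H = smult \<phi> Q + R" "phi_reduced \<phi> R" "F = R + pCons 0 Q"
    using phi_expansion_mult[OF mon deg red eq] .
  have R: "degree (coeff R i) < degree \<phi>" for i using QR(2) by (simp add: phi_reduced_def)
  have GH: "coeff Q i * \<phi> + coeff R i = (\<Sum>j\<le>i. coeff G j * coeff H (i - j))" for i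
    using arg_cong[OF QR(1), of "\<lambda>P. coeff P i"] by (simp add: mult.commute coeff_mult)
  have carry: "?P dvd coeff (pCons 0 Q) ?J"
  proof (cases ?J)
    case 0
    then show ?thesis by simp
  next
    case (Suc n)
    have "?P dvd (\<Sum>j\<le>n. coeff G j * coeff H (n - j))"
      by (intro dvd_sum subdiag) (use Suc in auto)
    then have "?P dvd coeff Q n" using monic_mult_dvd_degree(1)[OF mon _ R] GH by metis
    then show ?thesis by (simp add: Suc)
  qed
  have "?P dvd coeff F ?J - coeff (pCons 0 Q) ?J" using F carry by (rule dvd_diff)
  then have dR: "?P dvd coeff R ?J" by (simp add: QR(3))
  have "(\<Sum>j\<le>?J. coeff G j * coeff H (?J - j)) =
      coeff G i0 * coeff H (?J - i0) + (\<Sum>j\<in>{..?J} - {i0}. coeff G j * coeff H (?J - j))"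
    by (rule sum.remove) auto
  with GH[of ?J] have split: "coeff G i0 * coeff H l0 - coeff Q ?J * \<phi> =
      coeff R ?J - (\<Sum>j\<in>{..?J} - {i0}. coeff G j * coeff H (?J - j))"
    by (simp add: algebra_simps)
  have "?P dvd (\<Sum>j\<in>{..?J} - {i0}. coeff G j * coeff H (?J - j))"
    by (intro dvd_sum diag) auto
  with dR have d: "?P dvd coeff G i0 * coeff H l0 - coeff Q ?J * \<phi>" unfolding split by (rule dvd_diff)
  obtain u where u: "coeff G i0 = [:int p ^ a:] * u" using G(1) by blast
  obtain v where v: "coeff H l0 = [:int p ^ b:] * v" using H(1) by blast
  have p0: "int p \<noteq> 0" using p by auto
  have P: "?P = [:int p ^ (a + b):] * [:int p:]" by simp
  have uv: "coeff G i0 * coeff H l0 = [:int p ^ (a + b):] * (u * v)"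
    by (simp add: u v power_add mult.commute)
  \<comment> \<open>The outgoing carry must also be divisible by \<open>p ^ (a + b)\<close> before
    this power can be cancelled.\<close>
  have "[:int p ^ (a + b):] dvd coeff G i0 * coeff H l0 - coeff Q ?J * \<phi>"
    using d unfolding P by (rule dvd_mult_left)
  moreover have "[:int p ^ (a + b):] dvd coeff G i0 * coeff H l0" unfolding uv by (rule dvd_triv_left)
  ultimately have "[:int p ^ (a + b):] dvd coeff G i0 * coeff H l0 - (coeff G i0 * coeff H l0 - coeff Q ?J * \<phi>)"
    by (metis dvd_diff)
  then have "[:int p ^ (a + b):] dvd coeff Q ?J * \<phi> + 0" by simp
  then have "[:int p ^ (a + b):] dvd coeff Q ?J" by (rule monic_mult_dvd_degree(1)[OF mon]) (use deg in simp)
  then obtain q where q: "coeff Q ?J = [:int p ^ (a + b):] * q" by blast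
  have "[:int p ^ (a + b):] * [:int p:] dvd [:int p ^ (a + b):] * (u * v - q * \<phi>)"
    using d unfolding P uv q by (simp only: right_diff_distrib mult.assoc)
  moreover have "[:int p ^ (a + b):] \<noteq> 0" using p0 by simp
  ultimately have "[:int p:] dvd u * v - q * \<phi>" by (metis dvd_mult_cancel_left)
  moreover have "degree (coeff G i0) < degree \<phi>" "degree (coeff H l0) < degree \<phi>"
    using red(1,2) by (auto simp: phi_reduced_def)
  then have "degree u < degree \<phi>" "degree v < degree \<phi>"
    using u v p0 by simp_all
  moreover have "\<not> [:int p:] dvd u"
  proof
    assume "[:int p:] dvd u"
    then have "[:int p ^ a:] * [:int p:] dvd coeff G i0" unfolding u by (rule mult_dvd_mono[OF dvd_refl])
    then show False using G(2) by (simp add: mult.commute)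
  qed
  moreover have "\<not> [:int p:] dvd v"
  proof
    assume "[:int p:] dvd v"
    then have "[:int p ^ b:] * [:int p:] dvd coeff H l0" unfolding v by (rule mult_dvd_mono[OF dvd_refl])
    then show False using H(2) by (simp add: mult.commute)
  qed
  ultimately show False using irreducible_m_prime[OF p mon irr] by blast
qed

section \<open>Newton polygons and degrees of factors\<close>

lemma exact_power_dvd_const:
  assumes "prime p" "(x :: int poly) \<noteq> 0"
  shows "\<exists>a. [:int p ^ a:] dvd x \<and> \<not> [:int p ^ Suc a:] dvd x"
proof (intro exI conjI)
  have nz: "content x \<noteq> 0" and nu: "\<not> is_unit (int p)" using assms by auto
  show "[:int p ^ multiplicity (int p) (content x):] dvd x"
    by (simp add: const_poly_dvd_iff_dvd_content multiplicity_dvd)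
  show "\<not> [:int p ^ Suc (multiplicity (int p) (content x)):] dvd x"
    unfolding const_poly_dvd_iff_dvd_content power_dvd_iff_le_multiplicity[OF nz nu] by simp
qed

lemma lowest_coeff_not_dvd:
  assumes "\<not> [:int p:] dvd coeff G n"
  shows "\<exists>i\<le>n. \<not> [:int p:] dvd coeff G i \<and> (\<forall>j<i. [:int p:] dvd coeff G j)"
  using LeastI[of "\<lambda>i. \<not> [:int p:] dvd coeff G i", OF assms]
    Least_le[of "\<lambda>i. \<not> [:int p:] dvd coeff G i", OF assms] not_less_Least by blast

text \<open>\<open>k * A i + i\<close> is a lower bound for \<open>k\<close> times the height at \<open>i\<close> of the Newton polygon of
  \<open>G\<close>, sheared by slope \<open>1 / k\<close>; \<open>J\<close> is the right end of its minimal edge.\<close>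
lemma sheared_polygon_minimum:
  assumes p: "prime p" and k: "k \<ge> 1" and G: "G \<noteq> (0 :: int poly poly)"
  shows "\<exists>A J. (\<forall>i. [:int p ^ A i:] dvd coeff G i) \<and> \<not> [:int p ^ Suc (A J):] dvd coeff G J \<and>
    (\<forall>i. k * A J + J \<le> k * A i + i) \<and> (\<forall>i>J. k * A J + J < k * A i + i)"
proof -
  have "\<exists>B. \<forall>i. coeff G i \<noteq> 0 \<longrightarrow> [:int p ^ B i:] dvd coeff G i \<and> \<not> [:int p ^ Suc (B i):] dvd coeff G i"
    by (intro choice) (use exact_power_dvd_const[OF p] in blast)
  then obtain B where B: "\<And>i. coeff G i \<noteq> 0 \<Longrightarrow>
    [:int p ^ B i:] dvd coeff G i \<and> \<not> [:int p ^ Suc (B i):] dvd coeff G i" by blast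
  define w0 where "w0 = k * B (degree G) + degree G"
  \<comment> \<open>A zero coefficient has no exact power; the value \<open>w0 + 1\<close> keeps it
    away from the minimum, which is at most \<open>w0\<close>.\<close>
  define A where "A i = (if coeff G i = 0 then w0 + 1 else B i)" for i
  define w where "w i = k * A i + i" for i
  have w0: "w0 = w (degree G)" using G by (simp add: w_def w0_def A_def)
  obtain i1 where i1: "\<And>i. w i1 \<le> w i" using ex_has_least_nat[of "\<lambda>_. True" 0 w] by auto
  define S where "S = {i. w i = w i1}"
  have "S \<subseteq> {..w i1}" by (auto simp: S_def w_def)
  then have fin: "finite S" using finite_subset by blast
  define J where "J = Max S"
  have "J \<in> S" unfolding J_def using fin by (intro Max_in) (auto simp: S_def)
  then have J: "w J = w i1" by (simp add: S_def)
  have less: "w J < w i" if "J < i" for i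
  proof -
    have "i \<notin> S" using Max_ge[OF fin, of i] that by (auto simp: J_def)
    then show ?thesis using i1[of i] J by (simp add: S_def)
  qed
  have "coeff G J \<noteq> 0"
  proof
    assume "coeff G J = 0"
    then have "w J \<ge> k * (w0 + 1)" by (simp add: w_def A_def)
    moreover have "k * (w0 + 1) \<ge> w0 + 1" using k mult_le_mono1[of 1 k "w0 + 1"] by simp
    ultimately show False using i1[of "degree G"] J w0 by linarith
  qed
  then have "\<not> [:int p ^ Suc (A J):] dvd coeff G J" using B by (simp add: A_def)
  moreover have "[:int p ^ A i:] dvd coeff G i" for i using B by (simp add: A_def)
  ultimately show ?thesis
    using i1 J less by (intro exI[of _ A] exI[of _ J]) (simp add: w_def)
qed

text \<open>If \<open>i\<close> and \<open>l\<close> are the lowest indices at which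
  \<open>G\<close> and \<open>H\<close> survive modulo \<open>p\<close>, then the coefficient of
  \<open>F\<close> at \<open>i + l\<close> survives too, so \<open>m \<le> i + l\<close>. Comparing
  degrees leaves no room for a nonconstant leading coefficient of \<open>G\<close>.\<close>

lemma factor_degree_multiple:
  fixes \<phi> g h :: "int poly"
  assumes p: "prime p" and mon: "monic \<phi>" and deg: "degree \<phi> > 0"
    and irr: "poly_mod.irreducible_m (int p) \<phi>"
    and F: "phi_reduced \<phi> F" "degree F = m" "coeff F m = [:c:]" "\<not> int p dvd c"
    and low: "\<And>j. j < m \<Longrightarrow> [:int p:] dvd coeff F j"
    and eq: "poly F \<phi> = g * h"
  shows "degree \<phi> dvd degree g"
proof -
  obtain G where G: "phi_reduced \<phi> G" "poly G \<phi> = g" using phi_expansion_exists[OF mon deg] by blast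
  obtain H where H: "phi_reduced \<phi> H" "poly H \<phi> = h" using phi_expansion_exists[OF mon deg] by blast
  have F0: "F \<noteq> 0" using F(3,4) by auto
  note dF = phi_expansion_degree[OF mon F(1) F0]
  have lc: "lead_coeff g * lead_coeff h = c" using dF F(2,3) eq by (simp add: lead_coeff_mult)
  have "c \<noteq> 0" using F(4) by auto
  then have gh0: "g \<noteq> 0" "h \<noteq> 0" using lc by auto
  then have GH0: "G \<noteq> 0" "H \<noteq> 0" using G(2) H(2) by auto
  note dG = phi_expansion_degree[OF mon G(1) GH0(1), unfolded G(2)]
  note dH = phi_expansion_degree[OF mon H(1) GH0(2), unfolded H(2)]
  have "degree (poly F \<phi>) = degree g + degree h" using gh0 unfolding eq by (rule degree_mult_eq)
  then have sum: "degree \<phi> * m = degree \<phi> * degree G + degree (lead_coeff G) + (degree \<phi> * degree H + degree (lead_coeff H))"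
    using dF dG dH F(2,3) by simp
  have "\<not> int p dvd lead_coeff (lead_coeff G)" "\<not> int p dvd lead_coeff (lead_coeff H)"
    using dG dH lc F(4) by auto
  then have nd: "\<not> [:int p:] dvd lead_coeff G" "\<not> [:int p:] dvd lead_coeff H"
    by (auto simp only: const_poly_dvd_iff)
  obtain i where i: "i \<le> degree G" "\<not> [:int p:] dvd coeff G i" "\<And>j. j < i \<Longrightarrow> [:int p:] dvd coeff G j"
    using lowest_coeff_not_dvd[OF nd(1)] by meson
  obtain l where l: "l \<le> degree H" "\<not> [:int p:] dvd coeff H l" "\<And>j. j < l \<Longrightarrow> [:int p:] dvd coeff H j"
    using lowest_coeff_not_dvd[OF nd(2)] by meson
  have one: "[:int p ^ 0:] dvd x" for x by (simp add: const_poly_dvd_iff)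
  have nG: "\<not> [:int p ^ Suc 0:] dvd coeff G i" and nH: "\<not> [:int p ^ Suc 0:] dvd coeff H l"
    using i(2) l(2) by simp_all
  have "\<not> [:int p ^ Suc (0 + 0):] dvd coeff F (i + l)"
  proof (rule phi_product_coeff_not_dvd[OF p mon deg irr G(1) H(1) F(1) _ one nG one nH])
    show "poly F \<phi> = poly G \<phi> * poly H \<phi>" using eq G(2) H(2) by simp
    show "[:int p ^ Suc (0 + 0):] dvd coeff G i' * coeff H l'" if "i' + l' = i + l" "(i', l') \<noteq> (i, l)" for i' l'
    proof -
      have "i' < i \<or> l' < l" using that by auto
      then show ?thesis using i(3) l(3) by (metis add_0 dvd_mult dvd_mult2 power_one_right One_nat_def)
    qed
    show "[:int p ^ Suc (0 + 0):] dvd coeff G i' * coeff H l'" if "Suc (i' + l') = i + l" for i' l'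
    proof -
      have "i' < i \<or> l' < l" using that by auto
      then show ?thesis using i(3) l(3) by (metis add_0 dvd_mult dvd_mult2 power_one_right One_nat_def)
    qed
  qed
  then have "\<not> [:int p:] dvd coeff F (i + l)" by simp
  then have "m \<le> i + l" using low by (meson not_le)
  then have "m \<le> degree G + degree H" using i(1) l(1) by simp
  then have "degree \<phi> * m \<le> degree \<phi> * (degree G + degree H)" by (rule mult_le_mono2)
  then have "degree (lead_coeff G) = 0" using sum by (simp add: distrib_left)
  then show ?thesis using dG by simp
qed

text \<open>The hypothesis \<open>slope\<close> puts every point of the polygon of \<open>F\<close>
  with positive index strictly above the line of slope \<open>- 1 / k\<close> through height
  \<open>v\<close> at 0. Hence the sheared minimum of \<open>G\<close> lies at 0 only. As
  \<open>G\<close> has degree \<open>k\<close> and its top coefficient is prime to \<open>p\<close>,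
  its constant coefficient is not divisible by \<open>p\<close> either, and this makes the
  horizontal edge of \<open>F\<close> too long.\<close>

lemma no_factor_of_degree:
  fixes \<phi> g h :: "int poly"
  assumes p: "prime p" and mon: "monic \<phi>" and deg: "degree \<phi> > 0"
    and irr: "poly_mod.irreducible_m (int p) \<phi>"
    and F: "phi_reduced \<phi> F" "degree F = m" "coeff F m = [:c:]" "\<not> int p dvd c"
    and k: "1 \<le> k" "k \<le> m"
    and low: "\<And>j. j \<le> m - k \<Longrightarrow> [:int p:] dvd coeff F j"
    and v: "\<not> [:int p ^ Suc v:] dvd coeff F 0"
    and slope: "\<And>j e. 1 \<le> j \<Longrightarrow> j \<le> m \<Longrightarrow> k * e + j \<le> k * v \<Longrightarrow> [:int p ^ Suc e:] dvd coeff F j"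
    and eq: "poly F \<phi> = g * h"
  shows "degree g \<noteq> k * degree \<phi>"
proof
  assume dg: "degree g = k * degree \<phi>"
  obtain G where G: "phi_reduced \<phi> G" "poly G \<phi> = g" using phi_expansion_exists[OF mon deg] by blast
  obtain H where H: "phi_reduced \<phi> H" "poly H \<phi> = h" using phi_expansion_exists[OF mon deg] by blast
  have eq': "poly F \<phi> = poly G \<phi> * poly H \<phi>" using eq G(2) H(2) by simp
  have F0: "F \<noteq> 0" using F(3,4) by auto
  note dF = phi_expansion_degree[OF mon F(1) F0]
  have lc: "lead_coeff g * lead_coeff h = c" using dF F(2,3) eq by (simp add: lead_coeff_mult)
  have "c \<noteq> 0" using F(4) by auto
  then have gh0: "g \<noteq> 0" "h \<noteq> 0" using lc by auto
  then have GH0: "G \<noteq> 0" "H \<noteq> 0" using G(2) H(2) by auto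
  note dG = phi_expansion_degree[OF mon G(1) GH0(1), unfolded G(2)]
  note dH = phi_expansion_degree[OF mon H(1) GH0(2), unfolded H(2)]
  have "degree (poly F \<phi>) = degree g + degree h" using gh0 unfolding eq by (rule degree_mult_eq)
  then have "degree \<phi> * m = degree \<phi> * k + degree h" using dF dg F(2,3) by simp
  then have dh: "degree h = degree \<phi> * (m - k)" by (simp add: diff_mult_distrib2)
  have "degree (lead_coeff G) < degree \<phi>" "degree (lead_coeff H) < degree \<phi>"
    using G(1) H(1) by (auto simp: phi_reduced_def)
  then have "degree g div degree \<phi> = degree G" "degree h div degree \<phi> = degree H"
    using dG dH by simp_all
  then have degs: "degree G = k" "degree H = m - k" using dg dh deg by simp_all
  have "\<not> int p dvd lead_coeff (lead_coeff G)" "\<not> int p dvd lead_coeff (lead_coeff H)"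
    using dG dH lc F(4) by auto
  then have nd: "\<not> [:int p:] dvd coeff G k" "\<not> [:int p:] dvd coeff H (m - k)"
    by (auto simp only: const_poly_dvd_iff degs)
  obtain A J where A: "\<And>i. [:int p ^ A i:] dvd coeff G i" "\<not> [:int p ^ Suc (A J):] dvd coeff G J"
    "\<And>i. k * A J + J \<le> k * A i + i" "\<And>i. J < i \<Longrightarrow> k * A J + J < k * A i + i"
    using sheared_polygon_minimum[OF p k(1) GH0(1)] by meson
  obtain B L where B: "\<And>i. [:int p ^ B i:] dvd coeff H i" "\<not> [:int p ^ Suc (B L):] dvd coeff H L"
    "\<And>i. k * B L + L \<le> k * B i + i" "\<And>i. L < i \<Longrightarrow> k * B L + L < k * B i + i"
    using sheared_polygon_minimum[OF p k(1) GH0(2)] by meson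
  have prod_dvd: "[:int p ^ e:] dvd coeff G i * coeff H l" if "e \<le> A i + B l" for e i l
  proof -
    have "[:int p ^ A i:] * [:int p ^ B l:] dvd coeff G i * coeff H l" using A(1) B(1) by (rule mult_dvd_mono)
    moreover have "[:int p ^ e:] dvd [:int p ^ A i:] * [:int p ^ B l:]"
      using that by (simp add: power_add[symmetric] le_imp_power_dvd)
    ultimately show ?thesis by (rule dvd_trans[rotated])
  qed
  have JL: "\<not> [:int p ^ Suc (A J + B L):] dvd coeff F (J + L)"
  proof (rule phi_product_coeff_not_dvd[OF p mon deg irr G(1) H(1) F(1) eq' A(1,2) B(1,2)])
    show "[:int p ^ Suc (A J + B L):] dvd coeff G i * coeff H l" if "i + l = J + L" "(i, l) \<noteq> (J, L)" for i l
    proof (rule prod_dvd)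
      have "J < i \<or> L < l" using that by auto
      then have "k * (A J + B L) < k * (A i + B l)"
        using A(3,4)[of i] B(3,4)[of l] that(1) by (auto simp: distrib_left)
      then show "Suc (A J + B L) \<le> A i + B l" by simp
    qed
    show "[:int p ^ Suc (A J + B L):] dvd coeff G i * coeff H l" if "Suc (i + l) = J + L" for i l
    proof (rule prod_dvd)
      have "k * (A J + B L) < k * (A i + B l)"
        using A(3)[of i] B(3)[of l] that by (auto simp: distrib_left)
      then show "Suc (A J + B L) \<le> A i + B l" by simp
    qed
  qed
  have "J = 0"
  proof (rule ccontr)
    assume "J \<noteq> 0"
    then have "1 \<le> J + L" by simp
    moreover have "J + L \<le> m" using JL F(2) by (metis coeff_eq_0 dvd_0_right not_le)
    \<comment> \<open>A positive index \<open>J + L\<close> would force both constant coefficients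
      so high that their product, and with it the constant coefficient of \<open>F\<close>, is
      divisible by \<open>p ^ Suc v\<close>.\<close>
    ultimately have "k * v < k * (A J + B L) + (J + L)" using slope[of "J + L" "A J + B L"] JL by linarith
    also have "\<dots> \<le> k * (A 0 + B 0)" using A(3)[of 0] B(3)[of 0] by (simp add: distrib_left)
    finally have "Suc v \<le> A 0 + B 0" by simp
    then have "[:int p ^ Suc v:] dvd coeff F 0"
      by (intro phi_product_coeff_0_dvd[OF mon deg G(1) H(1) F(1) eq'] prod_dvd)
    with v show False by simp
  qed
  have "A k = 0"
  proof (rule ccontr)
    assume "A k \<noteq> 0"
    then have "[:int p:] dvd [:int p ^ A k:]" by simp
    then show False using A(1)[of k] nd(1) dvd_trans by blast
  qed
  \<comment> \<open>Strict minimality at 0, compared with index \<open>k\<close>, reads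
    \<open>k * A 0 < k\<close>.\<close>
  then have "A 0 = 0" using A(4)[of k] \<open>J = 0\<close> k(1) by simp
  then have G0: "\<not> [:int p:] dvd coeff G 0" using A(2) \<open>J = 0\<close> by simp
  obtain l where l: "l \<le> m - k" "\<not> [:int p:] dvd coeff H l" "\<And>j. j < l \<Longrightarrow> [:int p:] dvd coeff H j"
    using lowest_coeff_not_dvd[OF nd(2)] by meson
  have one: "[:int p ^ 0:] dvd x" for x by (simp add: const_poly_dvd_iff)
  have nG: "\<not> [:int p ^ Suc 0:] dvd coeff G 0" and nH: "\<not> [:int p ^ Suc 0:] dvd coeff H l"
    using G0 l(2) by simp_all
  have "\<not> [:int p ^ Suc (0 + 0):] dvd coeff F (0 + l)"
  proof (rule phi_product_coeff_not_dvd[OF p mon deg irr G(1) H(1) F(1) eq' one nG one nH])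
    show "[:int p ^ Suc (0 + 0):] dvd coeff G i' * coeff H l'" if "i' + l' = 0 + l" "(i', l') \<noteq> (0, l)" for i' l'
    proof -
      have "l' < l" using that by auto
      then show ?thesis using l(3) by (metis add_0 dvd_mult power_one_right One_nat_def)
    qed
    show "[:int p ^ Suc (0 + 0):] dvd coeff G i' * coeff H l'" if "Suc (i' + l') = 0 + l" for i' l'
    proof -
      have "l' < l" using that by auto
      then show ?thesis using l(3) by (metis add_0 dvd_mult power_one_right One_nat_def)
    qed
  qed
  with low[OF l(1)] show False by simp
qed

section \<open>Irreducibility\<close>

lemma irreducible_m_imp_degree_pos:
  fixes \<phi> :: "int poly"
  assumes "monic \<phi>" "poly_mod.irreducible_m p \<phi>"
  shows "degree \<phi> > 0"
proof (rule ccontr)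
  assume "\<not> ?thesis"
  then obtain c where "\<phi> = [:c:]" by (auto elim: degree_eq_zeroE)
  then have "\<phi> = 1" using assms(1) by simp
  then show False using assms(2) by (auto simp: poly_mod.irreducible_m_def poly_mod.dvdm_def)
qed

definition laguerre_expansion :: "nat \<Rightarrow> nat \<Rightarrow> int \<Rightarrow> (nat \<Rightarrow> int poly) \<Rightarrow> int poly poly" where
  "laguerre_expansion m \<alpha> am a =
     monom [:am:] m + (\<Sum>j<m. monom (smult (int (laguerre_coeff m \<alpha> j)) (a j)) j)"

lemma coeff_laguerre_expansion:
  "coeff (laguerre_expansion m \<alpha> am a) j =
    (if j = m then [:am:] else if j < m then smult (int (laguerre_coeff m \<alpha> j)) (a j) else 0)"
  by (simp add: laguerre_expansion_def coeff_sum)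

lemma poly_laguerre_expansion:
  "poly (laguerre_expansion m \<alpha> am a) \<phi> =
    smult am (\<phi> ^ m) + (\<Sum>j<m. smult (int (laguerre_coeff m \<alpha> j)) (a j * \<phi> ^ j))"
  by (simp add: laguerre_expansion_def poly_sum poly_monom)

lemma power_const_dvd_smult:
  assumes "p ^ e dvd b"
  shows "[:int p ^ e:] dvd smult (int b) f"
  using assms by (simp add: const_poly_dvd_iff flip: of_nat_power)

lemma no_laguerre_factor_of_degree:
  fixes \<phi> g h :: "int poly"
  assumes \<alpha>: "\<alpha> \<in> {0, 1, 2, 3, 4}" and m: "(m, \<alpha>) \<notin> {(2, 2), (4, 4), (6, 4)}"
    and mon: "monic \<phi>" and irr: "irreducible_mod_primes_upto (m + \<alpha>) \<phi>"
    and red: "phi_reduced \<phi> (laguerre_expansion m \<alpha> am a)"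
    and deg: "degree (laguerre_expansion m \<alpha> am a) = m"
    and am: "\<And>p. prime p \<Longrightarrow> p \<le> m + \<alpha> \<Longrightarrow> \<not> int p dvd am"
    and a0: "\<And>p. prime p \<Longrightarrow> p \<le> m + \<alpha> \<Longrightarrow> \<not> int p dvd content (a 0)"
    and k: "1 \<le> k" "2 * k \<le> m"
    and eq: "poly (laguerre_expansion m \<alpha> am a) \<phi> = g * h"
  shows "degree g \<noteq> k * degree \<phi>"
proof -
  let ?b = "laguerre_coeff m \<alpha>"
  obtain p where "excluding_prime m \<alpha> k p" using excluding_prime_exists[OF \<alpha> k m] by blast
  then have p: "prime p" and low: "\<And>j. j \<le> m - k \<Longrightarrow> p dvd ?b j"
    and slope: "\<And>j. 1 \<le> j \<Longrightarrow> j \<le> m \<Longrightarrow> k * multiplicity p (?b 0) < k * multiplicity p (?b j) + j"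
    by (auto simp: excluding_prime_def)
  \<comment> \<open>This product is \<open>fact (m + \<alpha>)\<close>, so \<open>p\<close> is among
    the primes to which the hypotheses on \<open>\<phi>\<close>, \<open>am\<close> and
    \<open>a 0\<close> apply.\<close>
  have "p dvd ?b 0 * fact (0 + \<alpha>)" using low[of 0] by simp
  then have "p dvd fact (m + \<alpha>)" by (subst (asm) laguerre_coeff_fact) simp_all
  then have ple: "p \<le> m + \<alpha>" using p by (simp add: prime_dvd_fact_iff)
  have irr_p: "poly_mod.irreducible_m (int p) \<phi>" using irr p ple by (auto simp: irreducible_mod_primes_upto_def)
  have d: "degree \<phi> > 0" by (rule irreducible_m_imp_degree_pos[OF mon irr_p])
  show ?thesis
  proof (rule no_factor_of_degree[OF p mon d irr_p red deg])
    show "coeff (laguerre_expansion m \<alpha> am a) m = [:am:]" by (simp add: coeff_laguerre_expansion)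
    show "\<not> int p dvd am" by (rule am[OF p ple])
    show "k \<le> m" using k by simp
    show "[:int p:] dvd coeff (laguerre_expansion m \<alpha> am a) j" if "j \<le> m - k" for j
    proof -
      have "j < m" using that k by linarith
      then show ?thesis using power_const_dvd_smult[of p 1 "?b j" "a j"] low[OF that]
        by (simp add: coeff_laguerre_expansion)
    qed
    show "\<not> [:int p ^ Suc (multiplicity p (?b 0)):] dvd coeff (laguerre_expansion m \<alpha> am a) 0"
    proof
      let ?e = "Suc (multiplicity p (?b 0))"
      assume "[:int p ^ ?e:] dvd coeff (laguerre_expansion m \<alpha> am a) 0"
      moreover have "0 < m" using k by simp
      ultimately have "int p ^ ?e dvd int (?b 0) * content (a 0)"
        by (simp add: coeff_laguerre_expansion const_poly_dvd_iff_dvd_content)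
      moreover have "coprime (int p ^ ?e) (content (a 0))"
        using prime_imp_coprime[of "int p" "content (a 0)"] p a0[OF p ple] by simp
      ultimately have "int (p ^ ?e) dvd int (?b 0)" by (simp add: coprime_dvd_mult_left_iff)
      then have "p ^ ?e dvd ?b 0" by (simp only: int_dvd_int_iff)
      moreover have "?b 0 \<noteq> 0" "\<not> is_unit p" using laguerre_coeff_pos[of 0 m \<alpha>] p by auto
      ultimately show False using power_dvd_iff_le_multiplicity[of "?b 0" p ?e] by simp
    qed
    show "[:int p ^ Suc e:] dvd coeff (laguerre_expansion m \<alpha> am a) j"
      if "1 \<le> j" "j \<le> m" "k * e + j \<le> k * multiplicity p (?b 0)" for j e
    proof -
      have "k * e < k * multiplicity p (?b j)" using slope[OF that(1,2)] that(3) by linarith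
      then have e: "Suc e \<le> multiplicity p (?b j)" by simp
      \<comment> \<open>Valuation 0 at index \<open>m\<close> contradicts the bound just obtained,
        so only indices below \<open>m\<close> remain.\<close>
      moreover have "?b m = 1" by (simp add: laguerre_coeff_def)
      ultimately have "j \<noteq> m" by auto
      then show ?thesis
        using power_const_dvd_smult[OF multiplicity_dvd'[OF e], of "a j"] that(2)
        by (simp add: coeff_laguerre_expansion)
    qed
  qed (use k eq in auto)
qed

theorem theorem1p2:
  fixes \<alpha> m :: nat and \<phi> :: "int poly" and am :: int and a :: "nat \<Rightarrow> int poly"
  assumes "\<alpha> \<in> {0, 1, 2, 3, 4}"
    and "m \<ge> 1"
    and "(m, \<alpha>) \<notin> {(1, 0), (2, 2), (4, 4), (6, 4)}"
    and "monic \<phi>"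
    and "irreducible_mod_primes_upto (m + \<alpha>) \<phi>"
    and "\<And>j. j < m \<Longrightarrow> degree (a j) < degree \<phi>"
    and "\<And>p::nat. prime p \<Longrightarrow> p \<le> m + \<alpha> \<Longrightarrow> \<not> int p dvd content (smult am (a 0))"
  shows "irreducible (gen_laguerre m \<alpha> \<phi> am a)"
proof -
  let ?b = "laguerre_coeff m \<alpha>"
  define F where "F = laguerre_expansion m \<alpha> am a"
  define f where "f = poly F \<phi>"
  \<comment> \<open>The pair (1, 0) is excluded so that some prime divides
    \<open>m + \<alpha>\<close>.\<close>
  have "m + \<alpha> \<noteq> 1" using assms(2,3) by auto
  then obtain q where q: "prime q" "q dvd m + \<alpha>" using prime_factor_nat by blast
  have qle: "q \<le> m + \<alpha>" using q(2) assms(2) by (intro dvd_imp_le) auto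
  have irr_q: "poly_mod.irreducible_m (int q) \<phi>"
    using assms(5) q(1) qle by (auto simp: irreducible_mod_primes_upto_def)
  have d: "degree \<phi> > 0" by (rule irreducible_m_imp_degree_pos[OF assms(4) irr_q])
  have am: "\<not> int p dvd am" and a0: "\<not> int p dvd content (a 0)" if "prime p" "p \<le> m + \<alpha>" for p
    using assms(7)[OF that] by auto
  have am0: "am \<noteq> 0" using am[OF q(1) qle] by auto
  have cF: "coeff F j = (if j = m then [:am:] else if j < m then smult (int (?b j)) (a j) else 0)" for j
    by (simp add: F_def coeff_laguerre_expansion)
  have red: "phi_reduced \<phi> F"
    using d assms(6) by (auto simp: phi_reduced_def cF intro: le_less_trans[OF degree_smult_le])
  have degF: "degree F = m"
    by (rule antisym[OF degree_le le_degree]) (use am0 in \<open>auto simp: cF\<close>)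
  have F0: "F \<noteq> 0" using cF[of m] am0 by auto
  have degf: "degree f = degree \<phi> * m"
    using phi_expansion_degree[OF assms(4) red F0] by (simp add: f_def degF cF)
  \<comment> \<open>\<open>q\<close> divides \<open>m + \<alpha>\<close>, a factor of every lower
    coefficient; hence \<open>F\<close> is a constant times a power of \<open>\<phi>\<close> modulo
    \<open>q\<close>.\<close>
  have low_q: "[:int q:] dvd coeff F j" if "j < m" for j
    using power_const_dvd_smult[of q 1 "?b j" "a j"] laguerre_coeff_dvd[of j m m q \<alpha>] q(2) that by (simp add: cF)
  have no_factor: "degree g \<noteq> k * degree \<phi>" if "f = g * h" "1 \<le> k" "2 * k \<le> m" for g h k
    using that assms(3) am a0 red degF unfolding f_def F_def
    by (intro no_laguerre_factor_of_degree[OF assms(1) _ assms(4,5)]) auto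
  have multiple: "degree \<phi> dvd degree g" if "f = g * h" for g h
    using factor_degree_multiple[OF q(1) assms(4) d irr_q red degF _ am[OF q(1) qle] low_q, of g h] that
    by (simp add: f_def cF)
  have int_factor: "degree g = 0 \<or> degree h = 0" if gh: "f = g * h" for g h
  proof (rule ccontr)
    assume pos: "\<not> ?thesis"
    obtain k where k: "degree g = k * degree \<phi>" using multiple[OF gh] by (metis dvdE mult.commute)
    obtain l where l: "degree h = l * degree \<phi>" using multiple[of h g] gh by (metis dvdE mult.commute)
    have "g \<noteq> 0" "h \<noteq> 0" using pos by auto
    then have "degree f = degree g + degree h" unfolding gh by (rule degree_mult_eq)
    then have "degree \<phi> * (k + l) = degree \<phi> * m" using degf k l by (simp add: algebra_simps)
    then have "k + l = m" using d by simp
    moreover have "1 \<le> k" "1 \<le> l" using pos k l by (auto simp: Suc_le_eq)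
    \<comment> \<open>One of the two factors has at most half of the degree, which is the range of
      the Newton polygon argument.\<close>
    ultimately consider "2 * k \<le> m" | "2 * l \<le> m" by linarith
    then show False
    proof cases
      case 1
      then show ?thesis using no_factor[OF gh \<open>1 \<le> k\<close>] k by simp
    next
      case 2
      then show ?thesis using no_factor[of h g l] gh \<open>1 \<le> l\<close> l by (simp add: mult.commute)
    qed
  qed
  let ?L = "gen_laguerre m \<alpha> \<phi> am a"
  have L: "?L = smult (1 / fact m) (map_poly rat_of_int f)"
    by (simp add: gen_laguerre_def f_def F_def poly_laguerre_expansion)
  have degL: "degree ?L = degree \<phi> * m" unfolding L using degf by simp
  have posL: "degree ?L > 0" unfolding degL using d assms(2) by simp
  show ?thesis
  proof (rule irreducibleI)
    show "?L \<noteq> 0" using posL by auto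
    show "\<not> is_unit ?L" using posL by (auto simp: is_unit_iff_degree)
    fix A B assume AB: "?L = A * B"
    then have "A \<noteq> 0" "B \<noteq> 0" using posL by auto
    have "map_poly rat_of_int f = smult (fact m) ?L" unfolding L by simp
    also have "\<dots> = smult (fact m) A * B" unfolding AB by simp
    finally obtain g h where "f = g * h" "degree g = degree (smult (fact m :: rat) A)" "degree h = degree B"
      using rat_factors_imp_int_factors by blast
    then have "degree A = 0 \<or> degree B = 0" using int_factor by fastforce
    then show "is_unit A \<or> is_unit B" using \<open>A \<noteq> 0\<close> \<open>B \<noteq> 0\<close> by (simp add: is_unit_iff_degree)
  qed
qed

end
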